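(* Let $\Gamma$ be a torsion-free abelian group and $\rho=(\rho_L,\rho_R):\Gamma\to G\times G$ a faithful representation. Then $\rho$ is admissible if and only if, up to conjugacy in $G\times G$ and up to exchanging the left and right factors, $\rho(\Gamma)$ is a discrete subgroup of one of the groups $A_{hyp}=\{(\exp(\lambda\Delta),\exp(\mu\Delta)):\lambda,\mu\in\mathbb R\}$, $A_{ext}=\{(\exp(\lambda\Delta),\exp(\eta H)):\lambda,\eta\in\mathbb R\}$, $A_{par}=\{(\exp(\lambda H),\exp(\lambda H)):\lambda\in\mathbb R\}$, where $\Delta=\begin{pmatrix}1&0\\0&-1\end{pmatrix}$ and $H=\begin{pmatrix}0&1\\0&0\end{pmatrix}$.
   Context: $G=\mathrm{PSL}(2,\mathbb{R})$, $\widetilde G$ its universal cover, $Z\cong\mathbb Z$ its center generated by $\delta$, $\mathcal Z$ the diagonal image of $Z$ in $\widetilde G\times\widetilde G$. The group $(\widetilde G\times\widetilde G)/\mathcal Z$ is the identity component of the isometry group of $\widetilde{\mathrm{AdS}}\cong\widetilde G$ (acting by $x\mapsto g_Lxg_R^{-1}$) and acts conformally on the conformal boundary $\widehat{\mathrm{Ein}}_2\cong\mathbb R\times S^1$ (conformal class of $d\theta^2-dt^2$), $\delta$ acting as $(t,\theta)\mapsto(t+\pi,\theta+\pi)$. An achronal subset of $\widehat{\mathrm{Ein}}_2$ has no two distinct causally related points; it is generic if it does not contain two points $x,\delta(x)$. $\rho$ is admissible if it is faithful, has discrete image, and lifts to $\tilde\rho:\Gamma\to(\widetilde G\times\widetilde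 G)/\mathcal Z$ preserving a generic closed achronal subset of $\widehat{\mathrm{Ein}}_2$ with at least two points.
   Formalization: Achronal is taken in the standard sense that no two points are joined by a timelike curve; if lightlike-related points were also forbidden, discrete subgroups of A_ext such as the one generated by (exp Δ, exp H) would not be admissible and the claim would fail. *)

theory Defs
  imports "HOL-Analysis.Analysis"
begin

type_synonym mat2 = "real^2^2"

definition mat2 :: "real \<Rightarrow> real \<Rightarrow> real \<Rightarrow> real \<Rightarrow> mat2" where
  "mat2 a b c d = (\<chi> i j. if i = 1 then (if j = 1 then a else b) else (if j = 1 then c else d))"

definition vec2 :: "real \<Rightarrow> real \<Rightarrow> real^2" where
  "vec2 x y = (\<chi> i. if i = 1 then x else y)"

definition SL2 :: "mat2 set" where
  "SL2 = {A. det A = 1}"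

definition psl :: "mat2 \<Rightarrow> mat2 set" where
  "psl A = {A, - A}"

definition PSL2 :: "mat2 set set" where
  "PSL2 = psl ` SL2"

definition psl_mult :: "mat2 set \<Rightarrow> mat2 set \<Rightarrow> mat2 set" where
  "psl_mult X Y = {A ** B | A B. A \<in> X \<and> B \<in> Y}"

definition psl_conj :: "mat2 \<Rightarrow> mat2 set \<Rightarrow> mat2 set" where
  "psl_conj M X = (\<lambda>A. M ** A ** matrix_inv M) ` X"

definition exp_Delta :: "real \<Rightarrow> mat2" where
  "exp_Delta l = mat2 (exp l) 0 0 (exp (- l))"

definition exp_H :: "real \<Rightarrow> mat2" where
  "exp_H e = mat2 1 e 0 1"

definition A_hyp :: "(mat2 set \<times> mat2 set) set" where
  "A_hyp = {(psl (exp_Delta l), psl (exp_Delta m)) | l m. True}"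

definition A_ext :: "(mat2 set \<times> mat2 set) set" where
  "A_ext = {(psl (exp_Delta l), psl (exp_H e)) | l e. True}"

definition A_par :: "(mat2 set \<times> mat2 set) set" where
  "A_par = {(psl (exp_H l), psl (exp_H l)) | l. True}"

text \<open>A subset S of G x G is discrete iff its (finite-to-one covering) preimage in
  SL(2,R) x SL(2,R) is discrete.\<close>
definition psl_discrete :: "(mat2 set \<times> mat2 set) set \<Rightarrow> bool" where
  "psl_discrete S = discrete {(A, B). \<exists>X Y. (X, Y) \<in> S \<and> A \<in> X \<and> B \<in> Y}"

text \<open>Lines of R^2 are parametrised by alpha in R/2piZ via the direction
  (cos(alpha/2), sin(alpha/2)).  The universal cover of G is realised as the group
  (under composition) of continuous lifts to R of the projective action on RP^1.
  Its centre is generated by delta = translation by 2 pi.\<close>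
definition dir :: "real \<Rightarrow> real^2" where
  "dir \<alpha> = vec2 (cos (\<alpha> / 2)) (sin (\<alpha> / 2))"

definition lifts :: "(real \<Rightarrow> real) \<Rightarrow> mat2 \<Rightarrow> bool" where
  "lifts f A \<longleftrightarrow> (\<forall>\<alpha>. \<exists>c. A *v dir \<alpha> = c *\<^sub>R dir (f \<alpha>))"

definition Gt :: "(real \<Rightarrow> real) set" where
  "Gt = {f. continuous_on UNIV f \<and> (\<exists>A\<in>SL2. lifts f A)}"

definition covers :: "(real \<Rightarrow> real) \<Rightarrow> mat2 set \<Rightarrow> bool" where
  "covers f X \<longleftrightarrow> (\<exists>A\<in>SL2. X = psl A \<and> lifts f A)"

text \<open>Null coordinates a = theta + t, b = theta - t, so d theta^2 - dt^2 = da db.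
  \<open>\<widehat>Ein_2\<close> = R^2 / <(2pi,2pi)>; subsets of it are represented by their saturated preimages
  in R^2.  (g_L, g_R) acts by (a,b) |-> (g_L a, g_R b); delta acts as (a,b) |-> (a+2pi, b).\<close>

definition ein_saturated :: "(real \<times> real) set \<Rightarrow> bool" where
  "ein_saturated \<Lambda> \<longleftrightarrow> (\<forall>p\<in>\<Lambda>. \<forall>k::int. (fst p + 2*pi*k, snd p + 2*pi*k) \<in> \<Lambda>)"

definition ein_eq :: "real \<times> real \<Rightarrow> real \<times> real \<Rightarrow> bool" where
  "ein_eq p q \<longleftrightarrow> (\<exists>k::int. q = (fst p + 2*pi*k, snd p + 2*pi*k))"

text \<open>p, q are joined by a timelike curve in \<open>\<widehat>Ein_2\<close>.\<close>
definition chron_related :: "real \<times> real \<Rightarrow> real \<times> real \<Rightarrow> bool" where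
  "chron_related p q \<longleftrightarrow>
     (\<exists>k::int. (fst q - fst p + 2*pi*k) * (snd q - snd p + 2*pi*k) < 0)"

definition achronal :: "(real \<times> real) set \<Rightarrow> bool" where
  "achronal \<Lambda> \<longleftrightarrow> (\<forall>p\<in>\<Lambda>. \<forall>q\<in>\<Lambda>. \<not> chron_related p q)"

definition generic :: "(real \<times> real) set \<Rightarrow> bool" where
  "generic \<Lambda> \<longleftrightarrow> (\<forall>p\<in>\<Lambda>. (fst p + 2*pi, snd p) \<notin> \<Lambda>)"

definition torsion_free :: "'g::ab_group_add itself \<Rightarrow> bool" where
  "torsion_free _ \<longleftrightarrow> (\<forall>(g::'g) (n::nat). n > 0 \<longrightarrow> ((\<lambda>x. x + g) ^^ n) 0 = 0 \<longrightarrow> g = 0)"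

definition psl_hom :: "('g::ab_group_add \<Rightarrow> mat2 set) \<Rightarrow> bool" where
  "psl_hom r \<longleftrightarrow> (\<forall>g. r g \<in> PSL2) \<and> (\<forall>x y. r (x + y) = psl_mult (r x) (r y))"

definition faithful :: "('g::ab_group_add \<Rightarrow> mat2 set) \<Rightarrow> ('g \<Rightarrow> mat2 set) \<Rightarrow> bool" where
  "faithful rL rR \<longleftrightarrow> inj (\<lambda>g. (rL g, rR g))"

definition rep_image :: "('g \<Rightarrow> mat2 set) \<Rightarrow> ('g \<Rightarrow> mat2 set) \<Rightarrow> (mat2 set \<times> mat2 set) set" where
  "rep_image rL rR = range (\<lambda>g. (rL g, rR g))"

text \<open>A lift to (Gt x Gt)/Z, given by representatives sL g, sR g in Gt: a homomorphism
  modulo the diagonal centre, projecting to rho, preserving Lambda.\<close>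
definition admissible :: "('g::ab_group_add \<Rightarrow> mat2 set) \<Rightarrow> ('g \<Rightarrow> mat2 set) \<Rightarrow> bool" where
  "admissible rL rR \<longleftrightarrow>
     faithful rL rR \<and> psl_discrete (rep_image rL rR) \<and>
     (\<exists>(sL :: 'g \<Rightarrow> real \<Rightarrow> real) (sR :: 'g \<Rightarrow> real \<Rightarrow> real) (\<Lambda> :: (real \<times> real) set).
        (\<forall>g. sL g \<in> Gt \<and> sR g \<in> Gt \<and> covers (sL g) (rL g) \<and> covers (sR g) (rR g)) \<and>
        (\<forall>x y. \<exists>k::int. sL (x + y) = (\<lambda>a. sL x (sL y a) + 2*pi*k) \<and>
                        sR (x + y) = (\<lambda>b. sR x (sR y b) + 2*pi*k)) \<and>
        ein_saturated \<Lambda> \<and> closed \<Lambda> \<and> achronal \<Lambda> \<and> generic \<Lambda> \<and>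
        (\<exists>p\<in>\<Lambda>. \<exists>q\<in>\<Lambda>. \<not> ein_eq p q) \<and>
        (\<forall>g. (\<lambda>(a, b). (sL g a, sR g b)) ` \<Lambda> = \<Lambda>))"

end

(* A closed achronal saturated set Lambda in the (a,b)-plane is a monotone relation that is invariant
   under translation by (2 pi, 2 pi), and generic means that it does not contain
   both (a, b) and (a, b + 2 pi).

   If (f, h) preserves Lambda and f has a fixed point, then an orbit stays in a bounded region by
   monotonicity, so h has a fixed point as well.  Hence an element of Gamma is elliptic on the left
   iff it is on the right; an element elliptic on both sides would have powers accumulating at the
   identity, contrary to discreteness and torsion-freeness.  So both projections of the abelian group
   Gamma are simultaneously diagonal or simultaneously unipotent.  If both are unipotent with
   parameters (a g, b g), then a g * b g < 0 is impossible: points of Lambda that are not fixed would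
   move in chronologically related directions, or converge to endpoints forbidden by genericity.
   The integral quadratic form (m a + n a')(m b + n b') is thus nonnegative, which forces all
   (a g, b g) onto one line of nonnegative slope.

   Conversely, lift each element so as to fix a common eigendirection, which makes the lift an exact
   homomorphism; Lambda is the orbit of two fixed points, or, for A_par, the graph of a lift of the
   conjugating matrix. *)

theory Submission
  imports Defs
begin

section \<open>Matrices and directions\<close>

text \<open>The main obstacle is that lifts are given only modulo the diagonal centre. An element
  with a real eigendirection on the left can be translated so that its left lift fixes a point, but
  the same multiple of 2 pi is then imposed on the right lift, whose fixed point must come from
  \<Lambda> and cannot be arranged by choice. Opposite parameters are excluded by using
  \<open>g\<close> and \<open>- g\<close> together: over a coordinate fixed by both, they push the
  other coordinate to opposite ends of an interval of length 2 pi, and closedness puts both ends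
  into \<Lambda>. Hence \<Lambda> has only doubly fixed points, and these form a single class
  although two are required. Commutation holds in \<open>PSL2\<close>, so for matrices only up to
  sign, and each centraliser computation must first rule out the minus sign. Finally, conjugating
  one factor by a diagonal matrix multiplies its unipotent parameters by a positive number; this
  turns a line of positive slope into the diagonal of \<open>A_par\<close>, and it could not correct
  a negative slope.\<close>

lemma mat2_nth [simp]:
  "mat2 a b c d $ 1 $ 1 = a" "mat2 a b c d $ 1 $ 2 = b"
  "mat2 a b c d $ 2 $ 1 = c" "mat2 a b c d $ 2 $ 2 = d"
  by (simp_all add: mat2_def)

lemma vec2_nth [simp]: "vec2 x y $ 1 = x" "vec2 x y $ 2 = y"
  by (simp_all add: vec2_def)

lemma matrix_mult_nth2:
  "((A::mat2) ** B) $ i $ j = A $ i $ 1 * B $ 1 $ j + A $ i $ 2 * B $ 2 $ j"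
  by (simp add: matrix_matrix_mult_def sum_2)

lemma matrix_vector_nth2: "((A::mat2) *v x) $ i = A $ i $ 1 * x $ 1 + A $ i $ 2 * x $ 2"
  by (simp add: matrix_vector_mult_def sum_2)

lemma mat1_nth [simp]:
  "(mat 1 :: mat2) $ 1 $ 1 = 1" "(mat 1 :: mat2) $ 1 $ 2 = 0"
  "(mat 1 :: mat2) $ 2 $ 1 = 0" "(mat 1 :: mat2) $ 2 $ 2 = 1"
  by (simp_all add: mat_def)

lemma mat2_eq_iff:
  "(A::mat2) = B \<longleftrightarrow> A $ 1 $ 1 = B $ 1 $ 1 \<and> A $ 1 $ 2 = B $ 1 $ 2 \<and> A $ 2 $ 1 = B $ 2 $ 1 \<and> A $ 2 $ 2 = B $ 2 $ 2"
  by (auto simp: vec_eq_iff forall_2)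

lemma vec2_eq_iff: "(u::real^2) = v \<longleftrightarrow> u $ 1 = v $ 1 \<and> u $ 2 = v $ 2"
  by (auto simp: vec_eq_iff forall_2)

text \<open>The adjugate: it is the inverse on \<open>SL2\<close> and linear in the entries, whereas
  \<open>matrix_inv\<close> is given by a choice operator.\<close>

definition adj2 :: "mat2 \<Rightarrow> mat2" where
  "adj2 A = mat2 (A $ 2 $ 2) (- A $ 1 $ 2) (- A $ 2 $ 1) (A $ 1 $ 1)"

lemma adj2_mult: "A \<in> SL2 \<Longrightarrow> adj2 A ** A = mat 1" "A \<in> SL2 \<Longrightarrow> A ** adj2 A = mat 1"
  by (auto simp: mat2_eq_iff matrix_mult_nth2 adj2_def SL2_def det_2 algebra_simps)

lemma matrix_inv_SL2: "A \<in> SL2 \<Longrightarrow> matrix_inv A = adj2 A"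
proof -
  assume A: "A \<in> SL2"
  have "A ** matrix_inv A = mat 1 \<and> matrix_inv A ** A = mat 1"
    unfolding matrix_inv_def by (rule someI[of _ "adj2 A"]) (simp add: adj2_mult A)
  then show ?thesis
    by (metis adj2_mult(1)[OF A] matrix_mul_assoc matrix_mul_lid matrix_mul_rid)
qed

lemma SL2_mult: "A \<in> SL2 \<Longrightarrow> B \<in> SL2 \<Longrightarrow> A ** B \<in> SL2"
  by (simp add: SL2_def det_mul)

lemma SL2_adj2: "A \<in> SL2 \<Longrightarrow> adj2 A \<in> SL2"
  by (simp add: SL2_def det_2 adj2_def algebra_simps)

lemma SL2_mat1: "mat 1 \<in> SL2"
  by (simp add: SL2_def)

lemma SL2_exp_Delta: "exp_Delta l \<in> SL2" and SL2_exp_H: "exp_H e \<in> SL2"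
  by (simp_all add: SL2_def exp_Delta_def exp_H_def det_2 flip: exp_add)

lemma minus_mult2: "(- A :: mat2) ** (B :: mat2) = - (A ** B)" "(A :: mat2) ** (- B :: mat2) = - (A ** B)"
  by (simp_all add: mat2_eq_iff matrix_mult_nth2)

lemma psl_minus: "psl (- A) = psl A"
  by (auto simp: psl_def)

lemma psl_eq_iff: "psl A = psl B \<longleftrightarrow> A = B \<or> A = - B"
  by (auto simp: psl_def doubleton_eq_iff)

lemma psl_mult_psl: "psl_mult (psl A) (psl B) = psl (A ** B)"
  by (auto simp: psl_mult_def psl_def minus_mult2) (metis minus_mult2(1))

lemma psl_conj_psl: "psl_conj M (psl A) = psl (M ** A ** matrix_inv M)"
  by (auto simp: psl_conj_def psl_def minus_mult2)

lemma conj_SL2_eq_iff: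
  assumes "M \<in> SL2"
  shows "M ** A ** matrix_inv M = B \<longleftrightarrow> A = adj2 M ** B ** M"
  unfolding matrix_inv_SL2[OF assms]
  by (metis adj2_mult assms matrix_mul_assoc matrix_mul_lid matrix_mul_rid)

lemma psl_conj_eq_psl_iff:
  assumes "M \<in> SL2"
  shows "psl_conj M (psl A) = psl B \<longleftrightarrow> psl A = psl (adj2 M ** B ** M)"
proof -
  have "- B = M ** A ** matrix_inv M \<longleftrightarrow> A = - (adj2 M ** B ** M)"
    using conj_SL2_eq_iff[OF assms, of A "- B"] by (auto simp: minus_mult2)
  then show ?thesis
    unfolding psl_conj_psl psl_eq_iff using conj_SL2_eq_iff[OF assms, of A B] by auto
qed

text \<open>The determinant of the matrix with columns \<open>u\<close> and \<open>v\<close>. It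
  makes collinearity an equation, is invariant under \<open>SL2\<close>, and on directions is a sine
  of half the angle difference; this is the bridge from matrices to lifts.\<close>

definition cross :: "real^2 \<Rightarrow> real^2 \<Rightarrow> real" where
  "cross u v = u $ 1 * v $ 2 - u $ 2 * v $ 1"

lemma cross_mult: "cross (A *v u) (A *v v) = det A * cross u v"
  by (simp add: cross_def matrix_vector_nth2 det_2 algebra_simps)

lemma cross_scale [simp]: "cross (c *\<^sub>R u) v = c * cross u v" "cross u (c *\<^sub>R v) = c * cross u v"
  by (simp_all add: cross_def algebra_simps)

lemma cross_dir: "cross (dir \<alpha>) (dir \<beta>) = sin ((\<beta> - \<alpha>) / 2)"
  by (simp add: cross_def dir_def diff_divide_distrib sin_diff algebra_simps)

lemma dir_nonzero [simp]: "dir \<alpha> \<noteq> 0"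
  using sin_cos_squared_add[of "\<alpha>/2"] by (auto simp: dir_def vec2_eq_iff simp del: sin_cos_squared_add)

lemma cross_eq_0:
  assumes "u \<noteq> 0" "cross u v = 0" shows "\<exists>c. v = c *\<^sub>R u"
proof (cases "u $ 1 = 0")
  case True
  then show ?thesis using assms
    by (intro exI[of _ "v $ 2 / u $ 2"]) (auto simp: cross_def vec2_eq_iff)
next
  case False
  then show ?thesis using assms
    by (intro exI[of _ "v $ 1 / u $ 1"]) (auto simp: cross_def vec2_eq_iff field_simps)
qed

lemma sin_half_eq_0: "sin (x / 2) = 0 \<longleftrightarrow> (\<exists>k::int. x = 2 * pi * k)"
  by (auto simp: sin_zero_iff_int2 mult_ac)

text \<open>With the half angle in \<open>dir\<close>, adding 2 pi is one full turn of the
  projective line and only changes the sign of the vector.\<close>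

lemma dir_parallel_iff: "(\<exists>c. dir \<beta> = c *\<^sub>R dir \<alpha>) \<longleftrightarrow> (\<exists>k::int. \<beta> = \<alpha> + 2 * pi * k)"
proof -
  have "(\<exists>c. dir \<beta> = c *\<^sub>R dir \<alpha>) \<longleftrightarrow> cross (dir \<alpha>) (dir \<beta>) = 0"
    using cross_eq_0[of "dir \<alpha>" "dir \<beta>"] by (auto simp: cross_def)
  also have "\<dots> \<longleftrightarrow> (\<exists>k::int. \<beta> - \<alpha> = 2 * pi * k)"
    by (simp add: cross_dir sin_half_eq_0)
  finally show ?thesis by (simp add: algebra_simps)
qed

lemma dir_exists: "v \<noteq> 0 \<Longrightarrow> \<exists>c \<alpha>. c \<noteq> 0 \<and> v = c *\<^sub>R dir \<alpha>"
proof -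
  assume v: "v \<noteq> (0::real^2)"
  define n where "n = sqrt ((v$1)\<^sup>2 + (v$2)\<^sup>2)"
  have p: "(v$1)\<^sup>2 + (v$2)\<^sup>2 > 0" using v
    by (metis sum_power2_gt_zero_iff vec2_eq_iff zero_index)
  then have n: "n > 0" "n\<^sup>2 = (v$1)\<^sup>2 + (v$2)\<^sup>2" by (simp_all add: n_def)
  have "(v$1 / n)\<^sup>2 + (v$2 / n)\<^sup>2 = 1"
    unfolding power_divide add_divide_distrib[symmetric] n(2)[symmetric] using n(1) by simp
  then obtain t where "v$1 / n = cos t" "v$2 / n = sin t"
    using sincos_total_2pi_le by metis
  then have "v = n *\<^sub>R dir (2*t)" using n by (auto simp: vec2_eq_iff dir_def field_simps)
  with n show ?thesis by (metis less_irrefl)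
qed

lemma mult_vec_SL2_nonzero: "A \<in> SL2 \<Longrightarrow> v \<noteq> 0 \<Longrightarrow> A *v v \<noteq> 0"
  by (metis adj2_mult(1) matrix_vector_mul_assoc matrix_vector_mul_lid matrix_vector_mult_0_right)

lemma minus_mult_vec2: "(- A :: mat2) *v x = - (A *v x)"
  by (simp add: vec2_eq_iff matrix_vector_nth2)

section \<open>Lifts to the universal cover\<close>

lemma lifts_iff_cross: "lifts f A \<longleftrightarrow> (\<forall>\<alpha>. cross (dir (f \<alpha>)) (A *v dir \<alpha>) = 0)"
proof -
  have "(\<exists>c. A *v dir \<alpha> = c *\<^sub>R dir (f \<alpha>)) \<longleftrightarrow> cross (dir (f \<alpha>)) (A *v dir \<alpha>) = 0" for \<alpha>
    using cross_eq_0[of "dir (f \<alpha>)" "A *v dir \<alpha>"] by (auto simp: cross_def)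
  then show ?thesis by (simp add: lifts_def)
qed

lemma lifts_uminus [simp]: "lifts f (- A) \<longleftrightarrow> lifts f A"
  by (auto simp: lifts_iff_cross minus_mult_vec2 cross_def)

lemma covers_psl: "A \<in> SL2 \<Longrightarrow> covers f (psl A) \<longleftrightarrow> lifts f A"
  by (auto simp: covers_def psl_eq_iff)

lemma covers_imp_lifts: "covers f X \<Longrightarrow> A \<in> X \<Longrightarrow> lifts f A"
  by (auto simp: covers_def psl_def)

lemma cross_dir_shift_eq_0:
  "cross (dir (x + 2 * pi * of_int k)) v = 0 \<longleftrightarrow> cross (dir x) v = 0"
proof -
  obtain c where c: "dir (x + 2 * pi * of_int k) = c *\<^sub>R dir x"
    using dir_parallel_iff by blast
  moreover have "c \<noteq> 0" using c dir_nonzero by force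
  ultimately show ?thesis by simp
qed

lemma lifts_shift: "lifts f A \<Longrightarrow> lifts (\<lambda>x. f x + 2 * pi * of_int k) A"
  by (simp add: lifts_iff_cross cross_dir_shift_eq_0)

lemma lifts_compose:
  assumes "lifts f A" "lifts g B" shows "lifts (\<lambda>x. f (g x)) (A ** B)"
  unfolding lifts_def
proof
  fix \<alpha>
  obtain c where c: "B *v dir \<alpha> = c *\<^sub>R dir (g \<alpha>)" using assms(2) by (auto simp: lifts_def)
  obtain d where d: "A *v dir (g \<alpha>) = d *\<^sub>R dir (f (g \<alpha>))" using assms(1) by (auto simp: lifts_def)
  have "(A ** B) *v dir \<alpha> = A *v (c *\<^sub>R dir (g \<alpha>))"
    by (simp add: c flip: matrix_vector_mul_assoc)
  also have "\<dots> = (c * d) *\<^sub>R dir (f (g \<alpha>))"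
    by (simp add: d matrix_vector_mult_scaleR)
  finally show "\<exists>c. (A ** B) *v dir \<alpha> = c *\<^sub>R dir (f (g \<alpha>))" by blast
qed

lemma continuous_nonzero_sign:
  fixes c :: "real \<Rightarrow> real"
  assumes "continuous_on UNIV c" "\<And>x. c x \<noteq> 0"
  shows "(\<forall>x. c x > 0) \<or> (\<forall>x. c x < 0)"
proof (rule ccontr)
  assume "\<not> ?thesis"
  then obtain x y where "c x < 0" "c y > 0" using assms(2) by (meson linorder_neqE)
  moreover have "connected (range c)" using assms(1) connected_continuous_image connected_UNIV by blast
  ultimately have "0 \<in> range c" by (meson connectedD_interval rangeI less_imp_le)
  then show False using assms(2) by auto
qed

text \<open>The factor never vanishes because \<open>A\<close> is invertible, and it is continuous,
  so its sign is constant. This sign is what later fixes orientations.\<close>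

lemma lifts_coeff:
  assumes "continuous_on UNIV f" "A \<in> SL2" "lifts f A"
  obtains c where "\<And>\<alpha>. A *v dir \<alpha> = c \<alpha> *\<^sub>R dir (f \<alpha>)" "\<And>\<alpha>. c \<alpha> \<noteq> 0"
    "(\<forall>\<alpha>. c \<alpha> > 0) \<or> (\<forall>\<alpha>. c \<alpha> < 0)"
proof -
  obtain c where c: "\<And>\<alpha>. A *v dir \<alpha> = c \<alpha> *\<^sub>R dir (f \<alpha>)"
    using assms(3) unfolding lifts_def by metis
  have nz: "c \<alpha> \<noteq> 0" for \<alpha>
    using c[of \<alpha>] mult_vec_SL2_nonzero[OF assms(2) dir_nonzero[of \<alpha>]] by auto
  \<comment> \<open>The inner product with the unit vector \<open>dir (f \<alpha>)\<close> recovers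
    the factor, which exhibits it as a continuous function.\<close>
  have "c \<alpha> = (A *v dir \<alpha>) $ 1 * cos (f \<alpha> / 2) + (A *v dir \<alpha>) $ 2 * sin (f \<alpha> / 2)" for \<alpha>
  proof -
    have w: "(A *v dir \<alpha>) $ 1 = c \<alpha> * cos (f \<alpha> / 2)" "(A *v dir \<alpha>) $ 2 = c \<alpha> * sin (f \<alpha> / 2)"
      unfolding c by (simp_all add: dir_def)
    have "(A *v dir \<alpha>) $ 1 * cos (f \<alpha> / 2) + (A *v dir \<alpha>) $ 2 * sin (f \<alpha> / 2)
        = c \<alpha> * ((cos (f \<alpha> / 2))\<^sup>2 + (sin (f \<alpha> / 2))\<^sup>2)"
      unfolding w by (simp only: power2_eq_square) algebra
    then show ?thesis by simp
  qed
  then have "c = (\<lambda>\<alpha>. (A$1$1 * cos (\<alpha>/2) + A$1$2 * sin (\<alpha>/2)) * cos (f \<alpha> / 2)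
      + (A$2$1 * cos (\<alpha>/2) + A$2$2 * sin (\<alpha>/2)) * sin (f \<alpha> / 2))"
    by (simp add: fun_eq_iff matrix_vector_nth2 dir_def)
  moreover have "continuous_on UNIV \<dots>"
    by (intro continuous_intros assms(1)) auto
  ultimately have "continuous_on UNIV c" by simp
  then show thesis using that c nz continuous_nonzero_sign by blast
qed

text \<open>Invariance of \<open>cross\<close> under \<open>A\<close> compares the two sines; the
  two factors from \<open>lifts_coeff\<close> have the same sign, so their product is a positive
  \<open>r\<close>.\<close>

lemma lifts_sin_scale:
  assumes "continuous_on UNIV f" "A \<in> SL2" "lifts f A"
  obtains r where "r > 0" "sin ((\<beta> - \<alpha>) / 2) = r * sin ((f \<beta> - f \<alpha>) / 2)"
proof -
  obtain c where c: "\<And>\<alpha>. A *v dir \<alpha> = c \<alpha> *\<^sub>R dir (f \<alpha>)"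
    "(\<forall>\<alpha>. c \<alpha> > 0) \<or> (\<forall>\<alpha>. c \<alpha> < 0)"
    using lifts_coeff[OF assms] by metis
  have "c \<alpha> * c \<beta> > 0" using c(2) by (auto simp: mult_neg_neg)
  moreover have "sin ((\<beta> - \<alpha>) / 2) = c \<alpha> * c \<beta> * sin ((f \<beta> - f \<alpha>) / 2)"
    using cross_mult[of A "dir \<alpha>" "dir \<beta>"] assms(2) by (simp add: c(1) cross_dir SL2_def mult.left_commute mult.assoc)
  ultimately show thesis using that by blast
qed

text \<open>The sine of half the increment stays positive up to \<beta>. By the intermediate value
  theorem the increment can then never reach 2 pi or -2 pi, where that sine vanishes, and within
  these bounds a positive sine means a positive increment.\<close>

lemma Gt_mono_local:
  assumes "f \<in> Gt" "\<alpha> < \<beta>" "\<beta> < \<alpha> + 2 * pi"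
  shows "f \<alpha> < f \<beta>" "f \<beta> < f \<alpha> + 2 * pi"
proof -
  obtain A where A: "continuous_on UNIV f" "A \<in> SL2" "lifts f A" using assms(1) by (auto simp: Gt_def)
  have pos: "sin ((f t - f \<alpha>) / 2) > 0" if "\<alpha> < t" "t \<le> \<beta>" for t
  proof -
    obtain r where r: "r > 0" "sin ((t - \<alpha>) / 2) = r * sin ((f t - f \<alpha>) / 2)"
      using lifts_sin_scale[OF A] by metis
    have "sin ((t - \<alpha>) / 2) > 0" using that assms(3) by (intro sin_gt_zero) auto
    then show ?thesis using r by (simp add: zero_less_mult_iff)
  qed
  have cont: "continuous_on {\<alpha>..\<beta>} f" using A(1) continuous_on_subset by blast
  have up: "f \<beta> < f \<alpha> + 2 * pi"
  proof (rule ccontr)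
    assume "\<not> ?thesis"
    then obtain t where t: "\<alpha> \<le> t" "t \<le> \<beta>" "f t = f \<alpha> + 2 * pi"
      using IVT'[of f \<alpha> "f \<alpha> + 2 * pi" \<beta>] cont assms(2) by auto
    then have "t \<noteq> \<alpha>" by auto
    then show False using pos[of t] t by simp
  qed
  then show "f \<beta> < f \<alpha> + 2 * pi" .
  have lo: "f \<alpha> - 2 * pi < f \<beta>"
  proof (rule ccontr)
    assume "\<not> ?thesis"
    then obtain t where t: "\<alpha> \<le> t" "t \<le> \<beta>" "f t = f \<alpha> - 2 * pi"
      using IVT2'[of f \<beta> "f \<alpha> - 2 * pi" \<alpha>] cont assms(2) by auto
    then have "t \<noteq> \<alpha>" by auto
    then show False using pos[of t] t by simp
  qed
  show "f \<alpha> < f \<beta>"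
  proof (rule ccontr)
    assume "\<not> ?thesis"
    then have "sin ((f \<alpha> - f \<beta>) / 2) \<ge> 0" using lo by (intro sin_ge_zero) auto
    moreover have "sin ((f \<alpha> - f \<beta>) / 2) = - sin ((f \<beta> - f \<alpha>) / 2)"
      by (metis minus_diff_eq minus_divide_left sin_minus)
    ultimately show False using pos[of \<beta>] assms(2) by simp
  qed
qed

lemma Gt_shift:
  assumes "f \<in> Gt" shows "f (\<alpha> + 2 * pi) = f \<alpha> + 2 * pi"
proof -
  obtain A where A: "continuous_on UNIV f" "A \<in> SL2" "lifts f A" using assms(1) by (auto simp: Gt_def)
  obtain r where r: "r > 0" "sin ((\<alpha> + 2 * pi - \<alpha>) / 2) = r * sin ((f (\<alpha> + 2 * pi) - f \<alpha>) / 2)"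
    using lifts_sin_scale[OF A] by metis
  then have "sin ((f (\<alpha> + 2 * pi) - f \<alpha>) / 2) = 0" by simp
  then obtain k :: int where k: "f (\<alpha> + 2 * pi) - f \<alpha> = 2 * pi * k" by (auto simp: sin_half_eq_0)
  \<comment> \<open>Two steps of length pi, since the local estimate covers only increments below 2
    pi; together they give an increment strictly between 0 and 4 pi.\<close>
  have *: "0 < 2 * pi * k" "2 * pi * k < 2 * pi * 2"
    using Gt_mono_local[OF assms, of \<alpha> "\<alpha> + pi"] Gt_mono_local[OF assms, of "\<alpha> + pi" "\<alpha> + 2 * pi"] k
      pi_gt_zero by linarith+
  then have "k = 1" by (simp add: zero_less_mult_iff)
  then show ?thesis using k by simp
qed

lemma Gt_shift_int:
  assumes "f \<in> Gt" shows "f (\<alpha> + 2 * pi * of_int k) = f \<alpha> + 2 * pi * of_int k"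
proof (induction k rule: int_induct[of _ 0])
  case base then show ?case by simp
next
  case (step1 i)
  then show ?case using Gt_shift[OF assms, of "\<alpha> + 2 * pi * of_int i"] by (simp add: algebra_simps)
next
  case (step2 i)
  then show ?case using Gt_shift[OF assms, of "\<alpha> + 2 * pi * of_int (i - 1)"] by (simp add: algebra_simps)
qed

lemma period_reduce: obtains k :: int where "a + 2 * pi * k \<le> x" "x < a + 2 * pi * k + 2 * pi"
proof
  let ?k = "\<lfloor>(x - a) / (2 * pi)\<rfloor>"
  have "?k \<le> (x - a) / (2 * pi)" "(x - a) / (2 * pi) < ?k + 1" by linarith+
  then have "?k * (2 * pi) \<le> x - a" "x - a < (?k + 1) * (2 * pi)"
    by (simp_all only: pos_le_divide_eq pos_divide_less_eq pi_gt_zero mult_pos_pos zero_less_numeral)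
  then show "a + 2 * pi * ?k \<le> x" "x < a + 2 * pi * ?k + 2 * pi" by (simp_all add: algebra_simps)
qed

lemma Gt_strict_mono:
  assumes "f \<in> Gt" shows "strict_mono f"
proof
  fix x y :: real assume "x < y"
  obtain k :: int where k: "x + 2 * pi * k \<le> y" "y < x + 2 * pi * k + 2 * pi" by (rule period_reduce)
  have "2 * pi * (- 1) < 2 * pi * k" using k(2) \<open>x < y\<close> by simp
  then have "-1 < real_of_int k" by (subst (asm) mult_less_cancel_left_pos) auto
  then have k0: "k \<ge> 0" by linarith
  show "f x < f y"
  proof (cases "x + 2 * pi * k = y")
    case True
    then have "k \<noteq> 0" using \<open>x < y\<close> by auto
    then show ?thesis using True Gt_shift_int[OF assms, of x k] k0 by auto
  next
    case False
    then have "f (x + 2 * pi * k) < f y" using k Gt_mono_local[OF assms] by auto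
    moreover have "2 * pi * k \<ge> 0" using k0 by simp
    ultimately show ?thesis using Gt_shift_int[OF assms, of x k] by linarith
  qed
qed

lemma Gt_continuous: "f \<in> Gt \<Longrightarrow> continuous_on UNIV f" by (simp add: Gt_def)

lemma Gt_translate: "f \<in> Gt \<Longrightarrow> (\<lambda>x. f x + 2 * pi * of_int k) \<in> Gt"
  by (auto simp: Gt_def intro!: continuous_intros lifts_shift)

text \<open>The difference of two lifts is continuous with values in the discrete set of multiples
  of 2 pi, hence constant.\<close>

lemma lifts_unique:
  assumes "continuous_on UNIV f" "continuous_on UNIV g" "A \<in> SL2" "lifts f A" "lifts g A"
  obtains k :: int where "\<And>x. g x = f x + 2 * pi * k"
proof -
  have k: "\<exists>k::int. g x - f x = 2 * pi * k" for x
  proof -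
    obtain c where c: "A *v dir x = c *\<^sub>R dir (f x)" using assms(4) by (auto simp: lifts_def)
    moreover have "c \<noteq> 0" using c mult_vec_SL2_nonzero[OF assms(3) dir_nonzero[of x]] by auto
    moreover have "cross (dir (g x)) (A *v dir x) = 0" using assms(5) by (simp add: lifts_iff_cross)
    ultimately have "sin ((f x - g x) / 2) = 0" by (simp add: cross_dir)
    then obtain k :: int where "f x - g x = 2 * pi * k" by (auto simp: sin_half_eq_0)
    then show ?thesis by (intro exI[of _ "-k"]) auto
  qed
  have "(\<lambda>x. g x - f x) constant_on UNIV"
  proof (rule continuous_discrete_range_constant)
    show "continuous_on UNIV (\<lambda>x. g x - f x)" using assms by (intro continuous_intros)
    fix x :: real
    have "2 * pi \<le> norm ((g y - f y) - (g x - f x))" if "g y - f y \<noteq> g x - f x" for y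
    proof -
      obtain i j :: int where ij: "g x - f x = 2 * pi * i" "g y - f y = 2 * pi * j" using k by metis
      have "j \<noteq> i" using that ij by auto
      then have "1 \<le> \<bar>real_of_int (j - i)\<bar>" by linarith
      then have "2 * pi * 1 \<le> 2 * pi * \<bar>real_of_int (j - i)\<bar>" by (intro mult_left_mono) auto
      also have "\<dots> = \<bar>2 * pi * real_of_int (j - i)\<bar>" by (simp add: abs_mult)
      finally show ?thesis using ij by (simp add: algebra_simps)
    qed
    then show "\<exists>e>0. \<forall>y. y \<in> UNIV \<and> g y - f y \<noteq> g x - f x \<longrightarrow> e \<le> norm (g y - f y - (g x - f x))"
      by (intro exI[of _ "2 * pi"]) auto
  qed auto
  then obtain d where d: "\<And>x. g x - f x = d" by (auto simp: constant_on_def)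
  obtain k :: int where "d = 2 * pi * k" using k d by metis
  then show thesis using that d by (metis add.commute diff_add_cancel)
qed

text \<open>This reduces identities between lifts, such as homomorphism and intertwining laws, to a
  check at one point.\<close>

lemma lifts_eq_if_agree:
  assumes "continuous_on UNIV f" "continuous_on UNIV g" "A \<in> SL2" "lifts f A" "lifts g A" "f x = g x"
  shows "f = g"
proof -
  obtain k :: int where "\<And>x. g x = f x + 2 * pi * k" using lifts_unique[OF assms(1-5)] by metis
  then show ?thesis using assms(6) by auto
qed

text \<open>The curve \<open>A *v dir x\<close>, read in the complex plane, avoids 0 and so has a
  continuous logarithm; its imaginary part is the angle. The value at \<open>a\<close> is then off
  by a multiple of 2 pi only, which a translation removes.\<close>

lemma lift_exists:
  assumes "A \<in> SL2" "cross (dir b) (A *v dir a) = 0"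
  obtains f where "f \<in> Gt" "lifts f A" "f a = b"
proof -
  define z where "z = (\<lambda>x. Complex ((A *v dir x) $ 1) ((A *v dir x) $ 2))"
  have z_eq: "z = (\<lambda>x. complex_of_real (A$1$1 * cos (x/2) + A$1$2 * sin (x/2))
      + \<i> * complex_of_real (A$2$1 * cos (x/2) + A$2$2 * sin (x/2)))"
    by (simp add: z_def fun_eq_iff complex_eq_iff matrix_vector_nth2 dir_def)
  have "continuous_on UNIV z" unfolding z_eq by (intro continuous_intros) auto
  moreover have "z x \<noteq> 0" for x
    using mult_vec_SL2_nonzero[OF assms(1) dir_nonzero[of x]]
    by (auto simp: z_def complex_eq_iff vec2_eq_iff)
  ultimately obtain g where g: "continuous_on UNIV g" "\<And>x. z x = exp (g x)"
    using continuous_logarithm_on_contractible[of UNIV z] convex_imp_contractible[OF convex_UNIV] by auto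
  \<comment> \<open>The factor 2 undoes the half angle in \<open>dir\<close>.\<close>
  define f where "f = (\<lambda>x. 2 * Im (g x))"
  have cf: "continuous_on UNIV f" unfolding f_def by (intro continuous_intros g)
  have f: "A *v dir x = exp (Re (g x)) *\<^sub>R dir (f x)" for x
    using g(2)[of x] by (simp add: complex_eq_iff z_def vec2_eq_iff f_def dir_def Re_exp Im_exp)
  then have lf: "lifts f A" by (auto simp: lifts_def)
  have "sin ((f a - b) / 2) = 0" using assms(2) by (simp add: f cross_dir)
  then obtain k :: int where k: "f a - b = 2 * pi * k" by (auto simp: sin_half_eq_0)
  show thesis
  proof (rule that[of "\<lambda>x. f x + 2 * pi * of_int (- k)"])
    show lf': "lifts (\<lambda>x. f x + 2 * pi * of_int (- k)) A" by (rule lifts_shift[OF lf])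
    show "(\<lambda>x. f x + 2 * pi * of_int (- k)) \<in> Gt"
      using lf' assms(1) cf by (auto simp: Gt_def intro!: continuous_intros)
    show "f a + 2 * pi * of_int (- k) = b" using k by simp
  qed
qed

section \<open>Invariant achronal sets\<close>

lemma achronal_mono:
  assumes "achronal \<Lambda>" "(a, b) \<in> \<Lambda>" "(a', b') \<in> \<Lambda>" "a < a'"
  shows "b \<le> b'"
proof (rule ccontr)
  assume "\<not> ?thesis"
  then have "(a' - a + 2 * pi * of_int 0) * (b' - b + 2 * pi * of_int 0) < 0"
    using assms(4) mult_pos_neg[of "a' - a" "b' - b"] by simp
  then have "chron_related (a, b) (a', b')" unfolding chron_related_def fst_conv snd_conv by blast
  then show False using assms by (auto simp: achronal_def)
qed

lemma saturated_shift:
  "ein_saturated \<Lambda> \<Longrightarrow> (a, b) \<in> \<Lambda> \<Longrightarrow> (a + 2 * pi * of_int k, b + 2 * pi * of_int k) \<in> \<Lambda>"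
  by (force simp: ein_saturated_def)

text \<open>Saturation absorbs the integer of \<open>chron_related\<close> into the second point, so
  monotonicity of the relation in the plane suffices.\<close>

lemma achronalI:
  assumes "ein_saturated \<Lambda>"
    and "\<And>a b a' b'. (a, b) \<in> \<Lambda> \<Longrightarrow> (a', b') \<in> \<Lambda> \<Longrightarrow> a < a' \<Longrightarrow> b \<le> b'"
  shows "achronal \<Lambda>"
  unfolding achronal_def
proof (intro ballI notI)
  fix p q assume "p \<in> \<Lambda>" "q \<in> \<Lambda>" "chron_related p q"
  then obtain k :: int where k: "(fst q - fst p + 2 * pi * k) * (snd q - snd p + 2 * pi * k) < 0"
    unfolding chron_related_def by blast
  define a' b' where "a' = fst q + 2 * pi * k" and "b' = snd q + 2 * pi * k"
  have "(a', b') \<in> \<Lambda>" "(fst p, snd p) \<in> \<Lambda>"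
    using saturated_shift[OF assms(1), of "fst q" "snd q" k] \<open>p \<in> \<Lambda>\<close> \<open>q \<in> \<Lambda>\<close> by (auto simp: a'_def b'_def)
  moreover have "(a' - fst p) * (b' - snd p) < 0" using k by (simp add: a'_def b'_def algebra_simps)
  ultimately show False
    using assms(2)[of "fst p" "snd p" a' b'] assms(2)[of a' b' "fst p" "snd p"]
    unfolding mult_less_0_iff by linarith
qed

text \<open>\<open>generic\<close> shifts the first coordinate; a diagonal translation of (a, b)
  turns that into a shift of the second.\<close>

lemma generic_vertical:
  assumes "ein_saturated \<Lambda>" "generic \<Lambda>" "(a, b) \<in> \<Lambda>" "(a, b + 2 * pi) \<in> \<Lambda>"
  shows False
  using saturated_shift[OF assms(1,3), of 1] assms(2,4) by (auto simp: generic_def)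

text \<open>An orbit of a monotone map is a monotone sequence, so a bounded one converges, and by
  continuity its limit is fixed. The last two conclusions record on which side of \<open>b\<close>
  the limit lies.\<close>

lemma orbit_limit:
  fixes h :: "real \<Rightarrow> real"
  assumes "continuous_on UNIV h" "mono h" "\<And>n. l \<le> (h ^^ n) b" "\<And>n. (h ^^ n) b \<le> u"
  obtains L where "(\<lambda>n. (h ^^ n) b) \<longlonglongrightarrow> L" "h L = L" "b \<le> h b \<Longrightarrow> b \<le> L" "h b \<le> b \<Longrightarrow> L \<le> b"
proof -
  have mono_iter: "mono (h ^^ n)" for n using assms(2) by (rule mono_pow)
  have up: "incseq (\<lambda>n. (h ^^ n) b)" if "b \<le> h b"
    using monoD[OF mono_iter that] by (intro incseq_SucI) (simp add: funpow_swap1)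
  have dn: "decseq (\<lambda>n. (h ^^ n) b)" if "h b \<le> b"
    using monoD[OF mono_iter that] by (intro decseq_SucI) (simp add: funpow_swap1)
  have "monoseq (\<lambda>n. (h ^^ n) b)" using up dn by (metis linear monoseq_iff)
  moreover have "Bseq (\<lambda>n. (h ^^ n) b)"
  proof (rule BseqI')
    show "norm ((h ^^ n) b) \<le> \<bar>l\<bar> + \<bar>u\<bar>" for n
      unfolding real_norm_def using assms(3)[of n] assms(4)[of n] by linarith
  qed
  ultimately obtain L where L: "(\<lambda>n. (h ^^ n) b) \<longlonglongrightarrow> L"
    using Bseq_monoseq_convergent convergentD by blast
  have "isCont h L" using assms(1) continuous_on_eq_continuous_at open_UNIV by blast
  then have "(\<lambda>n. h ((h ^^ n) b)) \<longlonglongrightarrow> h L" using L isCont_tendsto_compose by blast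
  moreover have "(\<lambda>n. h ((h ^^ n) b)) \<longlonglongrightarrow> L" using LIMSEQ_Suc[OF L] by simp
  ultimately have "h L = L" using LIMSEQ_unique by blast
  moreover have "b \<le> L" if "b \<le> h b" using incseq_le[OF up[OF that] L, of 0] by simp
  moreover have "L \<le> b" if "h b \<le> b" using decseq_ge[OF dn[OF that] L, of 0] by simp
  ultimately show thesis using that L by blast
qed

text \<open>One inclusion, which is the form suited to iteration; equality of the image is recovered
  from the inverse elements in \<open>admissibleI\<close>.\<close>

definition preserves :: "(real \<Rightarrow> real) \<Rightarrow> (real \<Rightarrow> real) \<Rightarrow> (real \<times> real) set \<Rightarrow> bool" where
  "preserves f h \<Lambda> \<longleftrightarrow> (\<forall>a b. (a, b) \<in> \<Lambda> \<longrightarrow> (f a, h b) \<in> \<Lambda>)"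

lemma preserves_iter: "preserves f h \<Lambda> \<Longrightarrow> (a, b) \<in> \<Lambda> \<Longrightarrow> ((f ^^ n) a, (h ^^ n) b) \<in> \<Lambda>"
  by (induction n) (auto simp: preserves_def)

lemma Gt_fixed_shift: "f \<in> Gt \<Longrightarrow> f x = x \<Longrightarrow> f (x + 2 * pi * of_int k) = x + 2 * pi * of_int k"
  by (simp add: Gt_shift_int)

lemma iter_between_fixed:
  assumes "strict_mono (f :: real \<Rightarrow> real)" "f l = l" "f u = u" "l \<le> x" "x \<le> u"
  shows "l \<le> (f ^^ n) x \<and> (f ^^ n) x \<le> u"
proof (induction n)
  case (Suc n)
  then show ?case using assms(1-3) strict_mono_less_eq[of f l "(f ^^ n) x"] strict_mono_less_eq[of f "(f ^^ n) x" u] by simp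
qed (use assms in auto)

text \<open>The zero case of: the two components of an element preserving \<open>\<Lambda>\<close> have equal
  translation numbers.\<close>

lemma fixed_point_transfer:
  assumes "ein_saturated \<Lambda>" "achronal \<Lambda>" "(a, b) \<in> \<Lambda>" "preserves f h \<Lambda>" "f \<in> Gt" "h \<in> Gt" "f x = x"
  obtains y where "h y = y"
proof -
  obtain k :: int where k: "x + 2 * pi * k \<le> a" "a < x + 2 * pi * k + 2 * pi" by (rule period_reduce)
  have fx: "f (x + 2 * pi * k) = x + 2 * pi * k" "f (x + 2 * pi * k + 2 * pi) = x + 2 * pi * k + 2 * pi"
    using Gt_shift_int[OF assms(5), of x k] Gt_shift[OF assms(5), of "x + 2 * pi * k"] assms(7) by auto
  have it: "x + 2 * pi * k \<le> (f ^^ n) a \<and> (f ^^ n) a \<le> x + 2 * pi * k + 2 * pi" for n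
    using iter_between_fixed[OF Gt_strict_mono[OF assms(5)] fx] k by auto
  have orb: "((f ^^ n) a, (h ^^ n) b) \<in> \<Lambda>" for n using preserves_iter assms(3,4) by blast
  \<comment> \<open>Two periods rather than one: the orbit of \<open>a\<close> may reach a + 2 pi,
    and the comparison of first coordinates must be strict.\<close>
  have "(h ^^ n) b \<le> b + 4 * pi" for n
  proof (rule achronal_mono[OF assms(2) orb])
    show "(a + 4 * pi, b + 4 * pi) \<in> \<Lambda>" using saturated_shift[OF assms(1,3), of 2] by simp
    show "(f ^^ n) a < a + 4 * pi" using it[of n] k pi_gt_zero by linarith
  qed
  moreover have "b - 4 * pi \<le> (h ^^ n) b" for n
  proof (rule achronal_mono[OF assms(2) _ orb])
    show "(a - 4 * pi, b - 4 * pi) \<in> \<Lambda>" using saturated_shift[OF assms(1,3), of "-2"] by simp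
    show "a - 4 * pi < (f ^^ n) a" using it[of n] k pi_gt_zero by linarith
  qed
  ultimately show thesis
    using orbit_limit[OF Gt_continuous[OF assms(6)] strict_mono_mono[OF Gt_strict_mono[OF assms(6)]]] that by metis
qed

text \<open>The dynamics of a lifted parabolic element when \<open>s\<close> is 1 or -1: one fixed
  point per period, and every other point is pushed in the direction \<open>s\<close>.\<close>

definition moves :: "(real \<Rightarrow> real) \<Rightarrow> real \<Rightarrow> real \<Rightarrow> bool" where
  "moves f x s \<longleftrightarrow> f \<in> Gt \<and> (\<forall>t. sgn (f t - t) = (if \<exists>k::int. t = x + 2 * pi * k then 0 else s))"

lemma moves_fixed: "moves f x s \<Longrightarrow> f (x + 2 * pi * of_int k) = x + 2 * pi * of_int k"
proof -
  assume "moves f x s"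
  then have "sgn (f (x + 2 * pi * of_int k) - (x + 2 * pi * of_int k)) = 0" by (auto simp: moves_def)
  then show ?thesis by (simp add: sgn_eq_0_iff)
qed

text \<open>Iteration keeps \<open>a\<close> and pushes \<open>b\<close> to the end of its interval
  between consecutive fixed points; closedness keeps the limit in \<Lambda>. The term
  \<open>(s + 1) * pi\<close> is 2 pi for s = 1 and 0 for s = -1, selecting the right or left
  end.\<close>

lemma moves_limit:
  assumes "closed \<Lambda>" "(a, b) \<in> \<Lambda>" "preserves f h \<Lambda>" "f a = a" "moves h y s" "s = 1 \<or> s = -1"
    "y + 2 * pi * of_int k < b" "b < y + 2 * pi * of_int k + 2 * pi"
  shows "(a, y + 2 * pi * of_int k + (s + 1) * pi) \<in> \<Lambda>"
proof -
  have hG: "h \<in> Gt" using assms(5) by (simp add: moves_def)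
  let ?l = "y + 2 * pi * of_int k" and ?u = "y + 2 * pi * of_int k + 2 * pi"
  have fx: "h ?l = ?l" "h ?u = ?u"
    using moves_fixed[OF assms(5)] Gt_shift[OF hG] by auto
  have it: "?l \<le> (h ^^ n) b \<and> (h ^^ n) b \<le> ?u" for n
    using iter_between_fixed[OF Gt_strict_mono[OF hG] fx] assms(7,8) by auto
  obtain L where L: "(\<lambda>n. (h ^^ n) b) \<longlonglongrightarrow> L" "h L = L" "b \<le> h b \<Longrightarrow> b \<le> L" "h b \<le> b \<Longrightarrow> L \<le> b"
    using orbit_limit[OF Gt_continuous[OF hG] strict_mono_mono[OF Gt_strict_mono[OF hG]]] it by metis
  have "(f ^^ n) a = a" for n using assms(4) by (induction n) auto
  then have "(a, (h ^^ n) b) \<in> \<Lambda>" for n using preserves_iter[OF assms(3,2), of n] by simp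
  moreover have "(\<lambda>n. (a, (h ^^ n) b)) \<longlonglongrightarrow> (a, L)" using L(1) by (intro tendsto_intros)
  ultimately have aL: "(a, L) \<in> \<Lambda>" using closed_sequentially[OF assms(1), of "\<lambda>n. (a, (h ^^ n) b)" "(a, L)"] by simp
  have Lb: "?l \<le> L" "L \<le> ?u"
    using LIMSEQ_le_const[OF L(1)] LIMSEQ_le_const2[OF L(1)] it by blast+
  have between: "\<nexists>j::int. t = y + 2 * pi * j" if "?l < t" "t < ?u" for t
  proof
    assume "\<exists>j::int. t = y + 2 * pi * j"
    then obtain j :: int where j: "t = y + 2 * pi * j" by blast
    then have "2 * pi * k < 2 * pi * j" "2 * pi * j < 2 * pi * (of_int k + 1)"
      using that by (auto simp: algebra_simps)
    then have "of_int k < real_of_int j" "real_of_int j < of_int k + 1"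
      by (simp_all only: mult_less_cancel_left_pos pi_gt_zero mult_pos_pos zero_less_numeral)
    then have "k < j" "j < k + 1" by linarith+
    then show False by simp
  qed
  have sg: "sgn (h t - t) = s" if "?l < t" "t < ?u" for t
    using between[OF that] assms(5) by (simp add: moves_def)
  have "\<not> (?l < L \<and> L < ?u)" using sg[of L] L(2) assms(6) by auto
  then have "L = ?l \<or> L = ?u" using Lb by auto
  moreover have "sgn (h b - b) = s" using sg assms(7,8) by auto
  ultimately have "L = ?l + (s + 1) * pi"
    using assms(6-8) L(3,4) by (auto simp: sgn_if split: if_splits)
  then show ?thesis using aL by simp
qed

text \<open>Otherwise the two opposite pushes would place both ends of the interval around
  \<open>b\<close> over the same \<open>a\<close>, the pair excluded by
  \<open>generic_vertical\<close>.\<close>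

lemma moves_vertical:
  assumes "ein_saturated \<Lambda>" "closed \<Lambda>" "generic \<Lambda>" "(a, b) \<in> \<Lambda>"
    and "preserves f h \<Lambda>" "preserves f' h' \<Lambda>" "f a = a" "f' a = a"
    and "moves h y s" "moves h' y (- s)" "s = 1 \<or> s = -1"
  shows "\<exists>k::int. b = y + 2 * pi * k"
proof (rule ccontr)
  assume no: "\<not> ?thesis"
  obtain k :: int where k: "y + 2 * pi * k \<le> b" "b < y + 2 * pi * k + 2 * pi" by (rule period_reduce)
  have k1: "y + 2 * pi * k < b" using k no by (metis order.order_iff_strict)
  have "(a, y + 2 * pi * k + (s + 1) * pi) \<in> \<Lambda>" "(a, y + 2 * pi * k + (- s + 1) * pi) \<in> \<Lambda>"
    using moves_limit[OF assms(2,4,5,7,9) _ k1 k(2)] moves_limit[OF assms(2,4,6,8,10) _ k1 k(2)] assms(11) by auto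
  then have "(a, y + 2 * pi * k) \<in> \<Lambda>" "(a, y + 2 * pi * k + 2 * pi) \<in> \<Lambda>"
    using assms(11) by auto
  then show False using generic_vertical[OF assms(1,3)] by blast
qed

section \<open>Exchange of the two null coordinates\<close>

lemma ein_saturated_swap: "ein_saturated \<Lambda> \<Longrightarrow> ein_saturated (prod.swap ` \<Lambda>)"
  unfolding ein_saturated_def by fastforce

lemma generic_swap:
  assumes "ein_saturated \<Lambda>" "generic \<Lambda>" shows "generic (prod.swap ` \<Lambda>)"
  using generic_vertical[OF assms] by (auto simp: generic_def)

lemma closed_swap: "closed \<Lambda> \<Longrightarrow> closed (prod.swap ` (\<Lambda> :: (real \<times> real) set))"
proof -
  assume c: "closed \<Lambda>"
  have "prod.swap ` \<Lambda> = prod.swap -` \<Lambda>" by force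
  moreover have "closed (prod.swap -` \<Lambda>)"
    by (rule closed_vimage[OF c]) (auto simp: prod.swap_def intro!: continuous_intros)
  ultimately show ?thesis by simp
qed

lemma achronal_swap: "achronal \<Lambda> \<Longrightarrow> achronal (prod.swap ` \<Lambda>)"
  by (auto simp: achronal_def chron_related_def mult.commute)

lemma preserves_swap: "preserves f h \<Lambda> \<Longrightarrow> preserves h f (prod.swap ` \<Lambda>)"
  by (auto simp: preserves_def)

text \<open>A point fixed in neither coordinate would move in chronologically related directions. So
  one coordinate is fixed, and \<open>moves_vertical\<close>, or its mirror image, forces the other
  one. Then \<Lambda> lies in the lattice of doubly fixed points, where monotonicity and genericity
  leave room for one class only.\<close>

lemma opposite_moves_False:
  assumes "ein_saturated \<Lambda>" "closed \<Lambda>" "achronal \<Lambda>" "generic \<Lambda>" "p \<in> \<Lambda>" "q \<in> \<Lambda>" "\<not> ein_eq p q"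
    and "preserves f h \<Lambda>" "preserves f' h' \<Lambda>"
    and "moves f x s" "moves h y (- s)" "moves f' x (- s)" "moves h' y s" "s = 1 \<or> s = -1"
  shows False
proof -
  have s': "- s = 1 \<or> - s = -1" using assms(14) by auto
  have either: "(\<exists>k::int. a = x + 2 * pi * k) \<or> (\<exists>k::int. b = y + 2 * pi * k)" if "(a, b) \<in> \<Lambda>" for a b
  proof (rule ccontr)
    assume "\<not> ?thesis"
    then have "sgn (f a - a) = s" "sgn (h b - b) = - s" using assms(10,11) by (simp_all add: moves_def)
    then have "(f a < a \<and> b < h b) \<or> (a < f a \<and> h b < b)"
      using assms(14) by (auto simp: sgn_if split: if_splits)
    moreover have "(f a, h b) \<in> \<Lambda>" using that assms(8) by (simp add: preserves_def)
    ultimately show False using achronal_mono[OF assms(3)] that by fastforce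
  qed
  have both: "(\<exists>k::int. a = x + 2 * pi * k) \<and> (\<exists>k::int. b = y + 2 * pi * k)" if ab: "(a, b) \<in> \<Lambda>" for a b
    using either[OF ab]
  proof
    assume A: "\<exists>k::int. a = x + 2 * pi * k"
    then have "f a = a" "f' a = a" using moves_fixed assms(10,12) by blast+
    then have "\<exists>k::int. b = y + 2 * pi * k"
      using moves_vertical[OF assms(1,2,4) ab assms(8,9) _ _ assms(11)] assms(13) s' by simp
    then show ?thesis using A by blast
  next
    assume B: "\<exists>k::int. b = y + 2 * pi * k"
    then have "h b = b" "h' b = b" using moves_fixed assms(11,13) by blast+
    then have "\<exists>k::int. a = x + 2 * pi * k"
      using moves_vertical[of "prod.swap ` \<Lambda>" b a h f h' f' x s] ab assms ein_saturated_swap closed_swap generic_swap preserves_swap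
      by simp
    then show ?thesis using B by blast
  qed
  obtain i j where p: "p = (x + 2 * pi * of_int i, y + 2 * pi * of_int j)" using both[of "fst p" "snd p"] assms(5)
    by (metis prod.collapse)
  obtain i' j' where q: "q = (x + 2 * pi * of_int i', y + 2 * pi * of_int j')" using both[of "fst q" "snd q"] assms(6)
    by (metis prod.collapse)
  have neq: "i' - i \<noteq> j' - j"
  proof
    assume "i' - i = j' - j"
    then have "q = (fst p + 2 * pi * of_int (i' - i), snd p + 2 * pi * of_int (i' - i))"
      unfolding p q fst_conv snd_conv prod.inject
      by (metis (no_types, opaque_lifting) add.assoc add.commute diff_add_cancel distrib_left of_int_add)
    then show False using assms(7) unfolding ein_eq_def by blast
  qed
  \<comment> \<open>In the column over \<open>x\<close>, heights differing by one period violate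
    genericity; larger gaps violate monotonicity against the diagonal translate of the lower
    point.\<close>
  have gen: "False" if "(x, y + 2 * pi * of_int m) \<in> \<Lambda>" "(x, y + 2 * pi * of_int n) \<in> \<Lambda>" "m < n" for m n :: int
  proof (cases "n = m + 1")
    case True
    then show False using generic_vertical[OF assms(1,4) that(1)] that(2) by (simp add: algebra_simps)
  next
    case False
    have sh: "(x + 2 * pi, y + 2 * pi * of_int (m + 1)) \<in> \<Lambda>"
      using saturated_shift[OF assms(1) that(1), of 1] by (simp add: algebra_simps)
    have "y + 2 * pi * of_int n \<le> y + 2 * pi * of_int (m + 1)"
      using achronal_mono[OF assms(3) that(2) sh] by simp
    then have "2 * pi * real_of_int n \<le> 2 * pi * of_int (m + 1)" by simp
    then have "real_of_int n \<le> of_int (m + 1)"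
      by (simp only: mult_le_cancel_left_pos pi_gt_zero mult_pos_pos zero_less_numeral)
    then show False using that(3) False by simp
  qed
  \<comment> \<open>Diagonal translations bring both points into the column over \<open>x\<close>;
    being inequivalent, they arrive at different heights.\<close>
  have "(x, y + 2 * pi * of_int (j - i)) \<in> \<Lambda>" "(x, y + 2 * pi * of_int (j' - i')) \<in> \<Lambda>"
    using saturated_shift[OF assms(1), of _ _ "- i"] saturated_shift[OF assms(1), of _ _ "- i'"] assms(5,6)
    by (force simp: p q algebra_simps)+
  then show False using gen[of "j - i" "j' - i'"] gen[of "j' - i'" "j - i"] neq by linarith
qed

section \<open>Parabolic and elliptic elements\<close>

lemma adj2_conj_vector:
  assumes "M \<in> SL2"
  shows "M *v ((adj2 M ** E ** M) *v v) = E *v (M *v v)"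
proof -
  have "M ** (adj2 M ** E ** M) = E ** M"
    by (simp add: matrix_mul_assoc adj2_mult(2)[OF assms])
  then show ?thesis by (simp add: matrix_vector_mul_assoc)
qed

lemma SL2_conj: "M \<in> SL2 \<Longrightarrow> E \<in> SL2 \<Longrightarrow> adj2 M ** E ** M \<in> SL2"
  by (simp add: SL2_mult SL2_adj2)

lemma SL2_injective: "M \<in> SL2 \<Longrightarrow> M *v u = M *v v \<Longrightarrow> u = v"
  by (metis adj2_mult(1) matrix_vector_mul_assoc matrix_vector_mul_lid)

lemma exp_H_vector: "exp_H a *v v = vec2 (v $ 1 + a * v $ 2) (v $ 2)"
  by (simp add: vec2_eq_iff matrix_vector_nth2 exp_H_def)

text \<open>Since \<open>M\<close> preserves \<open>cross\<close>, the product of the factor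
  \<open>c t\<close> and the sine of half the displacement is -a times a square. Once
  \<open>c\<close> is known to be positive, the lift moves against the sign of \<open>a\<close>, and
  it rests exactly where the square vanishes.\<close>

lemma moves_of_parabolic:
  assumes M: "M \<in> SL2" and f: "f \<in> Gt" "lifts f (adj2 M ** exp_H a ** M)" "f z = z"
    and a: "a \<noteq> 0" and x: "(M *v dir x) $ 2 = 0"
  shows "moves f x (- sgn a)"
proof -
  let ?A = "adj2 M ** exp_H a ** M"
  have A: "?A \<in> SL2" using SL2_conj[OF M SL2_exp_H] .
  obtain c where c: "\<And>\<alpha>. ?A *v dir \<alpha> = c \<alpha> *\<^sub>R dir (f \<alpha>)" "(\<forall>\<alpha>. c \<alpha> > 0) \<or> (\<forall>\<alpha>. c \<alpha> < 0)"
    using lifts_coeff[OF Gt_continuous[OF f(1)] A f(2)] by metis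
  have cM: "cross (M *v u) (M *v v) = cross u v" for u v
    using M by (simp add: cross_mult SL2_def)
  have key: "c t * sin ((f t - t) / 2) = - a * ((M *v dir t) $ 2)\<^sup>2" for t
  proof -
    have "c t * sin ((f t - t) / 2) = cross (dir t) (?A *v dir t)" by (simp add: c(1) cross_dir)
    also have "\<dots> = cross (M *v dir t) (exp_H a *v (M *v dir t))"
      by (metis cM adj2_conj_vector[OF M])
    also have "\<dots> = - a * ((M *v dir t) $ 2)\<^sup>2"
      by (simp add: exp_H_vector cross_def power2_eq_square algebra_simps)
    finally show ?thesis .
  qed
  have x1: "(M *v dir x) $ 1 \<noteq> 0"
    using mult_vec_SL2_nonzero[OF M dir_nonzero[of x]] x by (auto simp: vec2_eq_iff)
  have fx: "(M *v dir t) $ 2 = 0 \<longleftrightarrow> (\<exists>k::int. t = x + 2 * pi * k)" for t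
  proof -
    have "(M *v dir t) $ 2 = 0 \<longleftrightarrow> cross (M *v dir x) (M *v dir t) = 0"
      using x x1 by (simp add: cross_def)
    also have "\<dots> \<longleftrightarrow> (\<exists>k::int. t - x = 2 * pi * k)" by (simp only: cM cross_dir sin_half_eq_0)
    finally show ?thesis by (simp add: algebra_simps)
  qed
  have z: "(M *v dir z) $ 2 = 0" using key[of z] f(3) a by simp
  then obtain j :: int where j: "z = x + 2 * pi * j" using fx by blast
  \<comment> \<open>The unipotent matrix is the identity on its fixed line, so \<open>c\<close>
    equals 1 at \<open>z\<close>; having constant sign, it is positive everywhere.\<close>
  have "exp_H a *v (M *v dir z) = M *v dir z" using z by (simp add: exp_H_vector vec2_eq_iff)
  then have "?A *v dir z = dir z"
    by (metis adj2_conj_vector[OF M] SL2_injective[OF M])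
  then have "c z *\<^sub>R dir z = 1 *\<^sub>R dir z" using c(1)[of z] f(3) by simp
  then have "c z = 1" using dir_nonzero scaleR_right_imp_eq by blast
  then have pos: "c t > 0" for t using c(2) by (metis less_asym zero_less_one)
  have "sgn (f t - t) = (if \<exists>k::int. t = x + 2 * pi * k then 0 else - sgn a)" for t
  proof (cases "\<exists>k::int. t = x + 2 * pi * k")
    case True
    then obtain k :: int where k: "t = x + 2 * pi * k" by blast
    then have "t = z + 2 * pi * of_int (k - j)" using j by (simp add: algebra_simps)
    then have "f t = t" using Gt_fixed_shift[OF f(1,3), of "k - j"] by simp
    then show ?thesis using True by simp
  next
    case False
    \<comment> \<open>Both \<open>t\<close> and \<open>f t\<close> lie between consecutive fixed
      points, so the displacement is below 2 pi in absolute value and has the sign of the sine of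
      its half.\<close>
    obtain k :: int where k: "z + 2 * pi * k \<le> t" "t < z + 2 * pi * k + 2 * pi" by (rule period_reduce)
    have "z + 2 * pi * k = x + 2 * pi * of_int (j + k)" using j by (simp add: algebra_simps)
    then have "z + 2 * pi * k \<noteq> t" using False by metis
    then have "f (z + 2 * pi * k) < f t" "f t < f (z + 2 * pi * k + 2 * pi)"
      using Gt_strict_mono[OF f(1)] k by (simp_all add: strict_mono_less)
    then have "z + 2 * pi * k < f t" "f t < z + 2 * pi * k + 2 * pi"
      using Gt_fixed_shift[OF f(1,3), of k] Gt_shift[OF f(1), of "z + 2 * pi * k"] by simp_all
    then have bd: "\<bar>f t - t\<bar> < 2 * pi" using k by linarith
    have w: "((M *v dir t) $ 2)\<^sup>2 > 0" using False fx by auto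
    consider "a > 0" | "a < 0" using a by linarith
    then show ?thesis
    proof cases
      case 1
      then have "c t * sin ((f t - t) / 2) < 0" using w key[of t] by simp
      then have "sin ((f t - t) / 2) < 0" using pos[of t] by (simp add: mult_less_0_iff)
      then have "f t - t < 0" using sin_ge_zero[of "(f t - t) / 2"] bd by (cases "f t - t < 0") auto
      then show ?thesis using False 1 by simp
    next
      case 2
      then have "c t * sin ((f t - t) / 2) > 0" using w key[of t] by (simp add: mult_neg_pos)
      then have sp: "sin ((f t - t) / 2) > 0" using pos[of t] by (simp add: zero_less_mult_iff)
      have "(f t - t) / 2 > 0"
      proof (rule ccontr)
        assume "\<not> ?thesis"
        then have "0 \<le> - ((f t - t) / 2)" "- ((f t - t) / 2) \<le> pi" using bd by (simp_all add: abs_less_iff field_simps)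
        then have "0 \<le> - sin ((f t - t) / 2)" using sin_ge_zero sin_minus by metis
        then show False using sp by linarith
      qed
      then have "f t - t > 0" by simp
      then show ?thesis using False 2 by simp
    qed
  qed
  then show ?thesis using f(1) by (simp add: moves_def)
qed

text \<open>The eigendirection makes the displacement at \<open>x\<close> a multiple of 2 pi.
  Subtracting it from both components at once respects \<Lambda> by saturation; the second component
  admits no independent correction.\<close>

lemma normalize_lift:
  assumes "ein_saturated \<Lambda>" "preserves f h \<Lambda>" "f \<in> Gt" "h \<in> Gt" "A \<in> SL2" "lifts f A" "lifts h B"
    and "cross (dir x) (A *v dir x) = 0"
  obtains f' h' where "f' \<in> Gt" "h' \<in> Gt" "lifts f' A" "lifts h' B" "preserves f' h' \<Lambda>" "f' x = x"
proof -
  obtain c where c: "A *v dir x = c *\<^sub>R dir (f x)" using assms(6) by (auto simp: lifts_def)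
  have "c \<noteq> 0" using mult_vec_SL2_nonzero[OF assms(5) dir_nonzero[of x]] c by auto
  then have "sin ((f x - x) / 2) = 0" using assms(8) by (simp add: c cross_dir)
  then obtain k :: int where k: "f x - x = 2 * pi * k" by (auto simp: sin_half_eq_0)
  let ?s = "\<lambda>g x. g x + 2 * pi * of_int (- k)"
  show thesis
  proof (rule that[of "?s f" "?s h"])
    show "preserves (?s f) (?s h) \<Lambda>"
      using assms(2) saturated_shift[OF assms(1), of _ _ "- k"] unfolding preserves_def by blast
    show "?s f x = x" using k by simp
  qed (use assms(3,4) Gt_translate[of _ "- k"] lifts_shift[OF assms(6), of "- k"] lifts_shift[OF assms(7), of "- k"] in auto)
qed

text \<open>A fixed point on the projective line. On \<open>SL2\<close> its absence means that the
  matrix is elliptic.\<close>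

definition eigendir :: "mat2 \<Rightarrow> bool" where
  "eigendir A \<longleftrightarrow> (\<exists>x. cross (dir x) (A *v dir x) = 0)"

lemma eigendir_transfer:
  assumes "ein_saturated \<Lambda>" "achronal \<Lambda>" "p \<in> \<Lambda>" "preserves f h \<Lambda>" "f \<in> Gt" "h \<in> Gt"
    and "A \<in> SL2" "lifts f A" "lifts h B" "eigendir A"
  shows "eigendir B"
proof -
  obtain x where "cross (dir x) (A *v dir x) = 0" using assms(10) by (auto simp: eigendir_def)
  then obtain f' h' where f': "f' \<in> Gt" "h' \<in> Gt" "lifts h' B" "preserves f' h' \<Lambda>" "f' x = x"
    using normalize_lift[OF assms(1,4-9)] by metis
  obtain y where "h' y = y"
    using fixed_point_transfer[OF assms(1,2) _ f'(4,1,2,5), of "fst p" "snd p"] assms(3) by auto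
  then show ?thesis using f'(3) unfolding lifts_iff_cross eigendir_def by metis
qed

lemma eigendirI: "v \<noteq> 0 \<Longrightarrow> cross v (A *v v) = 0 \<Longrightarrow> eigendir A"
  using dir_exists[of v] by (auto simp: eigendir_def matrix_vector_mult_scaleR)

text \<open>Eigenvectors are the zeros of the binary quadratic form \<open>cross v (A *v v)\<close>,
  whose discriminant is the squared trace minus 4; a nonnegative discriminant would provide a real
  zero.\<close>

lemma not_eigendir_trace:
  assumes "A \<in> SL2" "\<not> eigendir A"
  shows "(A $ 1 $ 1 + A $ 2 $ 2)\<^sup>2 < 4"
proof (rule ccontr)
  assume tr: "\<not> ?thesis"
  define a b c d where "a = A $ 1 $ 1" "b = A $ 1 $ 2" "c = A $ 2 $ 1" "d = A $ 2 $ 2"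
  note abcd = this
  have det: "a * d - b * c = 1" using assms(1) by (simp add: SL2_def det_2 abcd)
  have cr: "cross v (A *v v) = c * (v$1)\<^sup>2 + (d - a) * v$1 * v$2 - b * (v$2)\<^sup>2" for v
    by (simp add: cross_def matrix_vector_nth2 abcd power2_eq_square algebra_simps)
  define D where "D = (d - a)\<^sup>2 + 4 * b * c"
  have "D = (a + d)\<^sup>2 - 4 * (a * d - b * c)" by (simp add: D_def power2_eq_square algebra_simps)
  then have "D \<ge> 0" using tr det by (simp add: abcd)
  then have sq: "sqrt D * sqrt D = D" by simp
  show False
  proof (cases "c = 0")
    case True
    have "eigendir A" by (rule eigendirI[of "vec2 1 0"]) (simp_all add: cr True vec2_eq_iff)
    then show False using assms(2) by simp
  next
    case False
    \<comment> \<open>The quadratic formula for the ratio of the coordinates, with the denominator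
      \<open>2 * c\<close> cleared.\<close>
    let ?v = "vec2 ((a - d) + sqrt D) (2 * c)"
    have "cross ?v (A *v ?v) = c * (sqrt D * sqrt D - D)"
      unfolding cr D_def by (simp add: power2_eq_square algebra_simps)
    then have "eigendir A" using False by (intro eigendirI[of ?v]) (auto simp: sq \<open>D \<ge> 0\<close> vec2_eq_iff)
    then show False using assms(2) by simp
  qed
qed

text \<open>For \<open>J\<close> with square -1 this is the one-parameter group exp (t J), the
  rotations for the complex structure \<open>J\<close>.\<close>

definition rotJ :: "mat2 \<Rightarrow> real \<Rightarrow> mat2" where
  "rotJ J t = cos t *\<^sub>R mat 1 + sin t *\<^sub>R J"

lemma rotJ_nth:
  "rotJ J t $ 1 $ 1 = cos t + sin t * J $ 1 $ 1" "rotJ J t $ 1 $ 2 = sin t * J $ 1 $ 2"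
  "rotJ J t $ 2 $ 1 = sin t * J $ 2 $ 1" "rotJ J t $ 2 $ 2 = cos t + sin t * J $ 2 $ 2"
  by (simp_all add: rotJ_def)

lemma rotJ_0 [simp]: "rotJ J 0 = mat 1" by (simp add: rotJ_def)

lemma rotJ_add:
  assumes "J ** J = - mat 1"
  shows "rotJ J s ** rotJ J t = rotJ J (s + t)"
proof -
  have J: "J$1$1 * J$1$1 + J$1$2 * J$2$1 = -1" "J$1$1 * J$1$2 + J$1$2 * J$2$2 = 0"
    "J$2$1 * J$1$1 + J$2$2 * J$2$1 = 0" "J$2$1 * J$1$2 + J$2$2 * J$2$2 = -1"
    using assms by (simp_all add: mat2_eq_iff matrix_mult_nth2)
  show ?thesis
    unfolding mat2_eq_iff matrix_mult_nth2 rotJ_nth cos_add sin_add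
    using J by (intro conjI; algebra)
qed

lemma rotJ_periodic: "rotJ J (t - 2 * pi * of_int k) = rotJ J t"
  by (simp add: rotJ_def cos_diff sin_diff)

text \<open>With half trace u, the Cayley-Hamilton identity gives that the square of A - u is u^2 -
  1, which is negative. Dividing A - u by s = sqrt (1 - u^2) gives \<open>J\<close>, and (u, s) lies
  on the unit circle.\<close>

lemma elliptic_rotJ:
  assumes "A \<in> SL2" "(A $ 1 $ 1 + A $ 2 $ 2)\<^sup>2 < 4"
  obtains J \<theta> where "J ** J = - mat 1" "A = rotJ J \<theta>"
proof -
  define u where "u = (A $ 1 $ 1 + A $ 2 $ 2) / 2"
  have u2: "u\<^sup>2 < 1" using assms(2) by (simp add: u_def power_divide)
  define s where "s = sqrt (1 - u\<^sup>2)"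
  have s: "s > 0" "s\<^sup>2 = 1 - u\<^sup>2" using u2 by (simp_all add: s_def)
  have "u\<^sup>2 + s\<^sup>2 = 1" using s by simp
  then obtain \<theta> where \<theta>: "u = cos \<theta>" "s = sin \<theta>" using sincos_total_2pi_le by metis
  define J where "J = (1 / s) *\<^sub>R (A - u *\<^sub>R mat 1)"
  define a b c d where "a = A $ 1 $ 1" "b = A $ 1 $ 2" "c = A $ 2 $ 1" "d = A $ 2 $ 2"
  note abcd = this
  have det: "a * d - b * c = 1" using assms(1) by (simp add: SL2_def det_2 abcd)
  have d: "d = 2 * u - a" by (simp add: u_def abcd field_simps)
  have Js: "s * J$1$1 = a - u" "s * J$1$2 = b" "s * J$2$1 = c" "s * J$2$2 = u - a"
    using s(1) d by (simp_all add: J_def abcd)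
  have "A = rotJ J \<theta>"
    using Js d by (simp add: mat2_eq_iff rotJ_nth abcd flip: \<theta>)
  moreover have "J ** J = - mat 1"
  proof -
    have Q: "s\<^sup>2 * (J$1$1 * J$1$1 + J$1$2 * J$2$1) = s\<^sup>2 * -1" "s\<^sup>2 * (J$1$1 * J$1$2 + J$1$2 * J$2$2) = s\<^sup>2 * 0"
      "s\<^sup>2 * (J$2$1 * J$1$1 + J$2$2 * J$2$1) = s\<^sup>2 * 0" "s\<^sup>2 * (J$2$1 * J$1$2 + J$2$2 * J$2$2) = s\<^sup>2 * -1"
      using Js det s(2) d by algebra+
    have "s\<^sup>2 \<noteq> 0" using s(1) by simp
    from Q[unfolded mult_left_cancel[OF this]] show ?thesis
      by (simp add: mat2_eq_iff matrix_mult_nth2)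
  qed
  ultimately show thesis using that by blast
qed

section \<open>Abelian subgroups\<close>

lemma psl_hom_rep:
  assumes "psl_hom r" obtains A where "A \<in> SL2" "r g = psl A"
proof -
  have "r g \<in> psl ` SL2" using assms by (simp add: psl_hom_def PSL2_def)
  then show thesis using that by blast
qed

lemma psl_hom_0:
  assumes "psl_hom (r :: 'g::ab_group_add \<Rightarrow> mat2 set)" shows "r 0 = psl (mat 1)"
proof -
  obtain A where A: "A \<in> SL2" "r 0 = psl A" using psl_hom_rep[OF assms] .
  have "r (0 + 0) = psl_mult (r 0) (r 0)" using assms by (simp only: psl_hom_def)
  then have "psl (A ** A) = psl A" using A by (simp add: psl_mult_psl)
  then have "A ** A = A \<or> A ** A = - A" by (simp add: psl_eq_iff)
  then have "adj2 A ** (A ** A) = adj2 A ** A \<or> adj2 A ** (A ** A) = - (adj2 A ** A)"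
    by (auto simp: minus_mult2)
  then have "A = mat 1 \<or> A = - mat 1" using adj2_mult[OF A(1)] by (simp add: matrix_mul_assoc)
  then have "psl A = psl (mat 1)" unfolding psl_eq_iff .
  then show ?thesis using A(2) by simp
qed

lemma psl_hom_funpow_rotJ:
  assumes "psl_hom r" "r g = psl (rotJ J \<theta>)" "J ** J = - mat 1"
  shows "r (((\<lambda>x. x + g) ^^ n) 0) = psl (rotJ J (real n * \<theta>))"
proof (induction n)
  case 0
  then show ?case using psl_hom_0[OF assms(1)] by simp
next
  case (Suc n)
  have "r (((\<lambda>x. x + g) ^^ n) 0 + g) = psl_mult (r (((\<lambda>x. x + g) ^^ n) 0)) (r g)"
    using assms(1) by (simp only: psl_hom_def)
  then show ?case using assms(2) Suc by (simp add: psl_mult_psl rotJ_add[OF assms(3)] algebra_simps)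
qed

text \<open>A single exponent must serve both factors, hence simultaneous Dirichlet approximation of
  \<theta> / (2 pi) and \<phi> / (2 pi). An error below 1 / N becomes 2 pi / N < d after
  rescaling.\<close>

lemma simultaneous_recurrence:
  fixes \<theta> \<phi> d :: real
  assumes "d > 0"
  obtains m :: nat and i j :: int
  where "m > 0" "\<bar>real m * \<theta> - 2 * pi * i\<bar> < d" "\<bar>real m * \<phi> - 2 * pi * j\<bar> < d"
proof -
  obtain N :: nat where N: "2 * pi / d < real N" using reals_Archimedean2 by blast
  then have "N > 0" using assms by (metis divide_pos_pos of_nat_0_less_iff order_less_trans pi_gt_zero mult_pos_pos zero_less_numeral)
  let ?t = "\<lambda>k::nat. (if k = 0 then \<theta> else \<phi>) / (2 * pi)"
  obtain q p where q: "0 < q" "\<And>k. k < 2 \<Longrightarrow> \<bar>of_int q * ?t k - of_int (p k)\<bar> < 1 / N"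
    using Dirichlet_approx_simult[OF \<open>N > 0\<close>, where n = 2 and \<theta> = ?t] by metis
  have *: "\<bar>of_int q * x - 2 * pi * of_int i\<bar> < d" if "\<bar>of_int q * (x / (2 * pi)) - of_int i\<bar> < 1 / N" for x and i :: int
  proof -
    have "of_int q * x - 2 * pi * of_int i = 2 * pi * (of_int q * (x / (2 * pi)) - of_int i)"
      by (simp add: field_simps)
    then have "\<bar>of_int q * x - 2 * pi * of_int i\<bar> = 2 * pi * \<bar>of_int q * (x / (2 * pi)) - of_int i\<bar>"
      by (simp add: abs_mult)
    also have "\<dots> < 2 * pi * (1 / N)" using that by (intro mult_strict_left_mono) auto
    also have "\<dots> < d" using N assms \<open>N > 0\<close> by (simp add: field_simps)
    finally show ?thesis .
  qed
  show thesis
    using that[of "nat q" "p 0" "p 1"] q(1) *[of \<theta> "p 0"] *[of \<phi> "p 1"] q(2)[of 0] q(2)[of 1] by simp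
qed

lemma psl_discrete_isolated:
  assumes "psl_discrete S" "(psl A, psl B) \<in> S"
  obtains e where "e > 0"
    "\<And>A' B'. (psl A', psl B') \<in> S \<Longrightarrow> dist (A, B) (A', B') < e \<Longrightarrow> A' = A \<and> B' = B"
proof -
  let ?D = "{(A, B). \<exists>X Y. (X, Y) \<in> S \<and> A \<in> X \<and> B \<in> Y}"
  have mem: "(psl A', psl B') \<in> S \<Longrightarrow> (A', B') \<in> ?D" for A' B' by (auto simp: psl_def)
  have "(A, B) isolated_in ?D" using assms(1) mem[OF assms(2)] unfolding psl_discrete_def discrete_def by blast
  then obtain e where e: "e > 0" "\<forall>y\<in>?D. dist (A, B) y < e \<longrightarrow> y = (A, B)"
    unfolding isolated_in_dist_Ex_iff by blast
  have "A' = A \<and> B' = B" if "(psl A', psl B') \<in> S" "dist (A, B) (A', B') < e" for A' B'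
    using e(2) mem[OF that(1)] that(2) by blast
  then show thesis using that e(1) by blast
qed

text \<open>A positive multiple of \<open>g\<close> is sent so close to the identity in both factors
  that discreteness makes it equal to the identity. Faithfulness and torsion-freeness then give g =
  0, but the matrices over the identity have squared trace 4.\<close>

lemma not_both_elliptic:
  fixes rL rR :: "'g::ab_group_add \<Rightarrow> mat2 set"
  assumes "torsion_free TYPE('g)" "psl_hom rL" "psl_hom rR" "faithful rL rR"
    and "psl_discrete (rep_image rL rR)"
    and A: "A \<in> SL2" "rL g = psl A" "(A $ 1 $ 1 + A $ 2 $ 2)\<^sup>2 < 4"
    and B: "B \<in> SL2" "rR g = psl B" "(B $ 1 $ 1 + B $ 2 $ 2)\<^sup>2 < 4"
  shows False
proof -
  obtain J \<theta> where J: "J ** J = - mat 1" "A = rotJ J \<theta>" using elliptic_rotJ[OF A(1,3)] .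
  obtain K \<phi> where K: "K ** K = - mat 1" "B = rotJ K \<phi>" using elliptic_rotJ[OF B(1,3)] .
  have mem: "(rL x, rR x) \<in> rep_image rL rR" for x by (simp add: rep_image_def)
  have "(psl (mat 1), psl (mat 1)) \<in> rep_image rL rR"
    using mem[of 0] psl_hom_0[OF assms(2)] psl_hom_0[OF assms(3)] by simp
  then obtain e where e: "e > 0"
    "\<And>A' B'. (psl A', psl B') \<in> rep_image rL rR \<Longrightarrow> dist (mat 1, mat 1) (A', B') < e \<Longrightarrow> A' = mat 1 \<and> B' = mat 1"
    using psl_discrete_isolated[OF assms(5)] by metis
  \<comment> \<open>Continuity of \<open>F\<close> at the origin turns small angles into matrices
    near the identity; the angles are first reduced modulo 2 pi, which leaves \<open>rotJ\<close>
    unchanged.\<close>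
  define F where "F = (\<lambda>p. (rotJ J (fst p), rotJ K (snd p)))"
  have "continuous_on UNIV F" unfolding F_def rotJ_def by (intro continuous_intros)
  then have "isCont F (0, 0)" by (simp add: continuous_on_eq_continuous_at)
  then obtain d where d: "d > 0" "\<And>p. dist p (0, 0) < d \<Longrightarrow> dist (F p) (F (0, 0)) < e"
    using e(1) unfolding continuous_at_eps_delta by metis
  obtain m :: nat and i j :: int where m: "m > 0"
    "\<bar>real m * \<theta> - 2 * pi * i\<bar> < d / 2" "\<bar>real m * \<phi> - 2 * pi * j\<bar> < d / 2"
    using simultaneous_recurrence[of "d / 2" \<theta> \<phi>] d(1) by auto
  let ?p = "(real m * \<theta> - 2 * pi * i, real m * \<phi> - 2 * pi * j)"
  have "dist ?p (0, 0) \<le> \<bar>real m * \<theta> - 2 * pi * i\<bar> + \<bar>real m * \<phi> - 2 * pi * j\<bar>"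
    using norm_Pair_le[of "fst ?p" "snd ?p"] by (simp add: dist_norm)
  then have "dist (F ?p) (F (0, 0)) < e" using d(2) m by auto
  then have near: "dist (mat 1, mat 1) (rotJ J (real m * \<theta>), rotJ K (real m * \<phi>)) < e"
    by (simp add: F_def rotJ_periodic dist_commute)
  let ?g = "((\<lambda>x. x + g) ^^ m) 0"
  have r: "rL ?g = psl (rotJ J (real m * \<theta>))" "rR ?g = psl (rotJ K (real m * \<phi>))"
    using psl_hom_funpow_rotJ[OF assms(2) _ J(1)] psl_hom_funpow_rotJ[OF assms(3) _ K(1)] A(2) B(2) J(2) K(2)
    by auto
  then have "(psl (rotJ J (real m * \<theta>)), psl (rotJ K (real m * \<phi>))) \<in> rep_image rL rR"
    using mem[of ?g] by simp
  then have "rotJ J (real m * \<theta>) = mat 1 \<and> rotJ K (real m * \<phi>) = mat 1" using e(2) near by blast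
  then have "rL ?g = rL 0" "rR ?g = rR 0" using r psl_hom_0[OF assms(2)] psl_hom_0[OF assms(3)] by simp_all
  then have "?g = 0" using assms(4) unfolding faithful_def inj_def by blast
  then have "g = 0" using assms(1) m(1) unfolding torsion_free_def by blast
  then have "psl A = psl (mat 1)" using psl_hom_0[OF assms(2)] A(2) by simp
  then show False using A(3) by (auto simp: psl_eq_iff)
qed

text \<open>Diagonal entries 1, 1 or -1, -1 give a unipotent matrix up to sign; distinct ones allow
  a shear to remove the off-diagonal entry. The sign of \<open>l\<close> is invisible in
  \<open>psl\<close>.\<close>

lemma upper_triangular_conj:
  assumes "U \<in> SL2" "U $ 2 $ 1 = 0"
  obtains S E where "S \<in> SL2" "E \<in> range exp_Delta \<or> E \<in> range exp_H" "psl U = psl (adj2 S ** E ** S)"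
proof -
  define l q where "l = U $ 1 $ 1" "q = U $ 1 $ 2"
  note lq = this
  have d: "l * U $ 2 $ 2 = 1" using assms by (simp add: SL2_def det_2 lq)
  then have l0: "l \<noteq> 0" by auto
  then have U22: "U $ 2 $ 2 = 1 / l" using d by (simp add: field_simps)
  show thesis
  proof (cases "l * l = 1")
    case True
    then have "l = 1 \<or> l = -1" by (simp add: square_eq_1_iff)
    then have "U = exp_H q \<or> U = - exp_H (- q)"
      using assms U22 by (auto simp: mat2_eq_iff exp_H_def lq)
    moreover have "adj2 (mat 1) ** E ** mat 1 = E" for E
      using adj2_mult(1)[OF SL2_mat1] by (simp add: matrix_mul_lid matrix_mul_rid)
    ultimately show thesis using that[OF SL2_mat1] by (metis psl_minus rangeI)
  next
    case False
    \<comment> \<open>Conjugating the diagonal matrix by a shear with entry \<open>t\<close> creates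
      the entry t (l - 1 / l), which has to equal \<open>q\<close>.\<close>
    define t where "t = q / (l - 1 / l)"
    have "l - 1 / l \<noteq> 0" using False l0 by (simp add: field_simps)
    then have t: "t * (l - 1 / l) = q" by (simp add: t_def)
    define S where "S = mat2 1 t 0 1"
    have S: "S \<in> SL2" by (simp add: S_def SL2_def det_2)
    define E where "E = exp_Delta (ln \<bar>l\<bar>)"
    have E: "E = mat2 \<bar>l\<bar> 0 0 (1 / \<bar>l\<bar>)" using l0 by (simp add: E_def exp_Delta_def exp_minus inverse_eq_divide)
    have "U = adj2 S ** E ** S \<or> U = - (adj2 S ** E ** S)"
    proof (cases "l > 0")
      case True
      then have "U = adj2 S ** E ** S" using assms t U22
        by (simp add: mat2_eq_iff matrix_mult_nth2 adj2_def S_def E lq) (simp add: algebra_simps)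
      then show ?thesis ..
    next
      case False
      then have "U = - (adj2 S ** E ** S)" using assms t U22 l0
        by (simp add: mat2_eq_iff matrix_mult_nth2 adj2_def S_def E lq) (simp add: algebra_simps)
      then show ?thesis ..
    qed
    then show thesis using that[OF S, of E] unfolding E_def psl_eq_iff by blast
  qed
qed

lemma adj2_compose: "adj2 (S ** M) = adj2 M ** adj2 S"
  unfolding mat2_eq_iff matrix_mult_nth2 adj2_def mat2_nth by (simp add: algebra_simps)

lemma eigendir_conj:
  assumes "A \<in> SL2" "eigendir A"
  obtains M E where "M \<in> SL2" "E \<in> range exp_Delta \<or> E \<in> range exp_H" "psl A = psl (adj2 M ** E ** M)"
proof -
  obtain x where x: "cross (dir x) (A *v dir x) = 0" using assms(2) by (auto simp: eigendir_def)
  \<comment> \<open>The rotation taking \<open>dir x\<close> to the first basis vector; an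
    eigendirection there means an upper triangular matrix.\<close>
  define R where "R = mat2 (cos (x/2)) (sin (x/2)) (- sin (x/2)) (cos (x/2))"
  have R: "R \<in> SL2" by (simp add: R_def SL2_def det_2 flip: power2_eq_square)
  define U where "U = R ** A ** adj2 R"
  have U: "U \<in> SL2" unfolding U_def using SL2_mult SL2_adj2 R assms(1) by blast
  have "U $ 2 $ 1 = cross (dir x) (A *v dir x)"
    by (simp add: U_def R_def adj2_def matrix_mult_nth2 cross_def matrix_vector_nth2 dir_def algebra_simps)
  then obtain S E where S: "S \<in> SL2" "E \<in> range exp_Delta \<or> E \<in> range exp_H" "psl U = psl (adj2 S ** E ** S)"
    using upper_triangular_conj[OF U] x by metis
  have "A = adj2 R ** U ** R"
    unfolding U_def by (metis R adj2_mult(1) matrix_mul_assoc matrix_mul_lid matrix_mul_rid)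
  then have "psl A = psl (adj2 (S ** R) ** E ** (S ** R))"
    using S(3) unfolding adj2_compose psl_eq_iff by (auto simp: matrix_mul_assoc minus_mult2)
  then show thesis using that[OF SL2_mult[OF S(1) R]] S(2) by blast
qed

text \<open>Commuting in \<open>PSL2\<close> means commuting or anticommuting. Anticommuting would
  annihilate the first row of \<open>B\<close>; commuting with distinct eigenvalues forces
  \<open>B\<close> to be diagonal.\<close>

lemma commutant_exp_Delta:
  assumes "B \<in> SL2" "l \<noteq> 0" "psl (B ** exp_Delta l) = psl (exp_Delta l ** B)"
  shows "\<exists>m. psl B = psl (exp_Delta m)"
proof -
  have ne: "exp l \<noteq> exp (- l)" using assms(2) by simp
  have pos: "exp l + exp (- l) > 0" by (simp add: add_pos_pos)
  have pos': "exp l > 0" "exp (-l) > 0" by auto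
  have off: "B $ 1 $ 2 = 0 \<and> B $ 2 $ 1 = 0"
  proof (rule ccontr)
    assume "\<not> ?thesis"
    then have neg: "B ** exp_Delta l \<noteq> exp_Delta l ** B"
      using ne by (auto simp: mat2_eq_iff matrix_mult_nth2 exp_Delta_def mult.commute)
    then have "B ** exp_Delta l = - (exp_Delta l ** B)" using assms(3) by (simp add: psl_eq_iff)
    then have "B $ 1 $ 1 * exp l = - (exp l * B $ 1 $ 1)" "B $ 1 $ 2 * exp (- l) = - (exp l * B $ 1 $ 2)"
      by (simp_all add: mat2_eq_iff matrix_mult_nth2 exp_Delta_def)
    then have "B $ 1 $ 1 * (2 * exp l) = 0" "B $ 1 $ 2 * (exp l + exp (- l)) = 0" by (simp_all add: algebra_simps)
    then have "B $ 1 $ 1 = 0" "B $ 1 $ 2 = 0" using pos by simp_all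
    then show False using assms(1) by (simp add: SL2_def det_2)
  qed
  define p where "p = B $ 1 $ 1"
  have pd: "p * B $ 2 $ 2 = 1" using assms(1) off by (simp add: SL2_def det_2 p_def)
  then have p0: "p \<noteq> 0" by auto
  then have B22: "B $ 2 $ 2 = 1 / p" using pd by (simp add: field_simps)
  have "B = exp_Delta (ln \<bar>p\<bar>) \<or> B = - exp_Delta (ln \<bar>p\<bar>)"
    using p0 off B22 by (auto simp: mat2_eq_iff exp_Delta_def exp_minus inverse_eq_divide p_def abs_if)
  then show ?thesis unfolding psl_eq_iff by blast
qed

text \<open>Here anticommuting would annihilate the first column. Commuting leaves an upper
  triangular matrix with equal diagonal entries, both 1 or both -1.\<close>

lemma commutant_exp_H:
  assumes "B \<in> SL2" "e \<noteq> 0" "psl (B ** exp_H e) = psl (exp_H e ** B)"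
  shows "\<exists>m. psl B = psl (exp_H m)"
proof -
  define a b c d where "a = B $ 1 $ 1" "b = B $ 1 $ 2" "c = B $ 2 $ 1" "d = B $ 2 $ 2"
  note abcd = this
  have det: "a * d - b * c = 1" using assms(1) by (simp add: SL2_def det_2 abcd)
  have "B ** exp_H e = exp_H e ** B"
  proof (rule ccontr)
    assume "\<not> ?thesis"
    then have "B ** exp_H e = - (exp_H e ** B)" using assms(3) by (simp add: psl_eq_iff)
    then have "(B ** exp_H e) $ 1 $ 1 = - (exp_H e ** B) $ 1 $ 1" "(B ** exp_H e) $ 2 $ 1 = - (exp_H e ** B) $ 2 $ 1"
      by simp_all
    then have ac: "a = - (a + e * c)" "c = - c"
      by (simp_all add: matrix_mult_nth2 exp_H_def abcd)
    then have "c = 0" by simp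
    then have "a = 0" "c = 0" using ac(1) by simp_all
    then show False using det by simp
  qed
  then have "a = a + e * c" "a * e + b = b + e * d"
    by (simp_all add: mat2_eq_iff matrix_mult_nth2 exp_H_def abcd)
  then have c: "c = 0" and ad: "a = d" using assms(2) by (simp_all add: mult.commute)
  then have "a = 1 \<or> a = -1" using det by (simp add: square_eq_1_iff)
  then have "B = exp_H b \<or> B = - exp_H (- b)"
    using c ad by (auto simp: mat2_eq_iff exp_H_def abcd)
  then show ?thesis unfolding psl_eq_iff by blast
qed

lemma exp_Delta_0 [simp]: "exp_Delta 0 = mat 1" and exp_H_0 [simp]: "exp_H 0 = mat 1"
  by (simp_all add: mat2_eq_iff exp_Delta_def exp_H_def)

lemma psl_cong_conj: "psl X = psl Y \<Longrightarrow> psl (P ** X ** Q) = psl (P ** Y ** Q)"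
  for P Q X Y :: mat2
  unfolding psl_eq_iff by (metis minus_mult2)

text \<open>One nontrivial element is put into normal form; all others lie in its centraliser, which
  is the corresponding one-parameter group. The trivial representation is listed as unipotent with
  parameter 0.\<close>

lemma abelian_conj:
  fixes r :: "'g::ab_group_add \<Rightarrow> mat2 set"
  assumes r: "psl_hom r" and eig: "\<And>g A. A \<in> SL2 \<Longrightarrow> r g = psl A \<Longrightarrow> eigendir A"
  obtains M where "M \<in> SL2"
    "(\<forall>g. \<exists>l. r g = psl (adj2 M ** exp_Delta l ** M)) \<or> (\<forall>g. \<exists>e. r g = psl (adj2 M ** exp_H e ** M))"
proof (cases "\<forall>g. r g = psl (mat 1)")
  case True
  have "adj2 (mat 1) ** mat 1 ** mat 1 = mat 1"
    using adj2_mult(1)[OF SL2_mat1] by (simp add: matrix_mul_rid)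
  then have "\<forall>g. r g = psl (adj2 (mat 1) ** exp_H 0 ** mat 1)" using True by simp
  then show thesis using that[OF SL2_mat1] by blast
next
  case False
  then obtain g0 where g0: "r g0 \<noteq> psl (mat 1)" by blast
  obtain A where A: "A \<in> SL2" "r g0 = psl A" using psl_hom_rep[OF r] .
  obtain M E where M: "M \<in> SL2" "E \<in> range exp_Delta \<or> E \<in> range exp_H" "psl A = psl (adj2 M ** E ** M)"
    using eigendir_conj[OF A(1) eig[OF A]] .
  have E1: "E \<noteq> mat 1"
    using g0 M(3) adj2_mult(1)[OF M(1)] A(2) by (auto simp: matrix_mul_rid)
  have com: "\<exists>B. r g = psl (adj2 M ** B ** M) \<and> B \<in> SL2 \<and> psl (B ** E) = psl (E ** B)" for g
  proof -
    obtain C where C: "C \<in> SL2" "r g = psl C" using psl_hom_rep[OF r] .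
    define B where "B = M ** C ** adj2 M"
    have "psl_mult (r g) (r g0) = psl_mult (r g0) (r g)"
      using r unfolding psl_hom_def by (metis add.commute)
    then have "psl (C ** (adj2 M ** E ** M)) = psl ((adj2 M ** E ** M) ** C)"
      using A(2) M(3) C(2) by (simp add: psl_mult_psl)
    from psl_cong_conj[OF this, of M "adj2 M"]
    have "psl (M ** (C ** (adj2 M ** E ** M)) ** adj2 M) = psl (M ** (adj2 M ** E ** M ** C) ** adj2 M)" .
    moreover have "M ** (C ** (adj2 M ** E ** M)) ** adj2 M = B ** E"
      unfolding B_def by (metis M(1) adj2_mult(2) matrix_mul_assoc matrix_mul_rid)
    moreover have "M ** (adj2 M ** E ** M ** C) ** adj2 M = E ** B"
      unfolding B_def by (metis M(1) adj2_mult(2) matrix_mul_assoc matrix_mul_lid)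
    moreover have "C = adj2 M ** B ** M"
      unfolding B_def by (metis M(1) adj2_mult(1) matrix_mul_assoc matrix_mul_lid matrix_mul_rid)
    moreover have "B \<in> SL2" unfolding B_def using SL2_mult SL2_adj2 M(1) C(1) by blast
    ultimately show ?thesis using C(2) by metis
  qed
  show thesis
  proof (rule that[OF M(1)], use M(2) in \<open>elim disjE imageE\<close>)
    fix l assume l: "E = exp_Delta l"
    then have "l \<noteq> 0" using E1 by auto
    have "\<exists>m. r g = psl (adj2 M ** exp_Delta m ** M)" for g
      using com[of g] commutant_exp_Delta[OF _ \<open>l \<noteq> 0\<close>] psl_cong_conj unfolding l by metis
    then show "(\<forall>g. \<exists>l. r g = psl (adj2 M ** exp_Delta l ** M)) \<or> (\<forall>g. \<exists>e. r g = psl (adj2 M ** exp_H e ** M))" by blast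
  next
    fix l assume l: "E = exp_H l"
    then have "l \<noteq> 0" using E1 by auto
    have "\<exists>m. r g = psl (adj2 M ** exp_H m ** M)" for g
      using com[of g] commutant_exp_H[OF _ \<open>l \<noteq> 0\<close>] psl_cong_conj unfolding l by metis
    then show "(\<forall>g. \<exists>l. r g = psl (adj2 M ** exp_Delta l ** M)) \<or> (\<forall>g. \<exists>e. r g = psl (adj2 M ** exp_H e ** M))" by blast
  qed
qed

section \<open>Admissible representations\<close>

text \<open>The preimage under \<Psi> of a neighbourhood isolating \<open>x\<close> isolates its
  image under \<Phi>.\<close>

lemma discrete_image:
  fixes \<Phi> :: "'a::topological_space \<Rightarrow> 'b::topological_space"
  assumes "discrete D" "continuous_on UNIV \<Psi>" "\<And>x. \<Psi> (\<Phi> x) = x"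
  shows "discrete (\<Phi> ` D)"
  unfolding discrete_def isolated_in_def
proof (intro ballI conjI)
  fix y assume "y \<in> \<Phi> ` D"
  then obtain x where x: "x \<in> D" "y = \<Phi> x" by blast
  then obtain T where T: "open T" "T \<inter> D = {x}" using assms(1) unfolding discrete_def isolated_in_def by blast
  have "\<Psi> -` T \<inter> \<Phi> ` D = {\<Phi> x}"
  proof (intro set_eqI iffI)
    fix z assume "z \<in> \<Psi> -` T \<inter> \<Phi> ` D"
    then obtain w where w: "w \<in> D" "z = \<Phi> w" "w \<in> T" using assms(3) by auto
    then have "w \<in> T \<inter> D" by simp
    then show "z \<in> {\<Phi> x}" unfolding T(2) using w(2) by simp
  qed (use T x assms(3) in auto)
  then show "\<exists>T. open T \<and> T \<inter> \<Phi> ` D = {y}"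
    using open_vimage[OF T(1) assms(2)] x(2) by blast
qed

lemma psl_discrete_swap: "psl_discrete S \<Longrightarrow> psl_discrete (prod.swap ` S)"
proof -
  assume "psl_discrete S"
  moreover have "{(A, B). \<exists>X Y. (X, Y) \<in> prod.swap ` S \<and> A \<in> X \<and> B \<in> Y}
      = prod.swap ` {(A, B). \<exists>X Y. (X, Y) \<in> S \<and> A \<in> X \<and> B \<in> Y}"
    by force
  moreover have "continuous_on UNIV (prod.swap :: mat2 \<times> mat2 \<Rightarrow> _)"
    unfolding prod.swap_def by (intro continuous_intros)
  ultimately show ?thesis
    unfolding psl_discrete_def using discrete_image[of _ prod.swap prod.swap] by simp
qed

lemma adj2_adj2 [simp]: "adj2 (adj2 M) = M"
  by (simp add: mat2_eq_iff adj2_def)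

lemma conj_adj2_cancel:
  assumes "M \<in> SL2" shows "adj2 M ** (M ** A ** adj2 M) ** M = A"
  by (metis assms adj2_mult(1) matrix_mul_assoc matrix_mul_lid matrix_mul_rid)

lemma psl_conj_adj2: "M \<in> SL2 \<Longrightarrow> psl_conj (adj2 M) (psl_conj M X) = X"
  by (simp add: psl_conj_def image_image matrix_inv_SL2 SL2_adj2 conj_adj2_cancel)

lemma psl_discrete_conj:
  assumes "M \<in> SL2" "N \<in> SL2" "psl_discrete S"
  shows "psl_discrete ((\<lambda>(X, Y). (psl_conj M X, psl_conj N Y)) ` S)"
proof -
  define \<Phi> where "\<Phi> = (\<lambda>(A, B). (M ** A ** adj2 M, N ** B ** adj2 N))"
  define \<Psi> where "\<Psi> = (\<lambda>p. (adj2 M ** fst p ** M, adj2 N ** snd p ** N))"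
  have "continuous_on UNIV \<Psi>"
    unfolding \<Psi>_def matrix_matrix_mult_def by (intro continuous_intros)
  moreover have "\<Psi> (\<Phi> p) = p" for p
    by (cases p) (simp add: \<Psi>_def \<Phi>_def conj_adj2_cancel assms)
  ultimately have "discrete (\<Phi> ` {(A, B). \<exists>X Y. (X, Y) \<in> S \<and> A \<in> X \<and> B \<in> Y})"
    using assms(3) discrete_image[of _ \<Psi> \<Phi>] unfolding psl_discrete_def by blast
  moreover have "{(A, B). \<exists>X Y. (X, Y) \<in> (\<lambda>(X, Y). (psl_conj M X, psl_conj N Y)) ` S \<and> A \<in> X \<and> B \<in> Y}
      = \<Phi> ` {(A, B). \<exists>X Y. (X, Y) \<in> S \<and> A \<in> X \<and> B \<in> Y}" (is "?L = ?R")
  proof (intro equalityI subsetI)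
    fix p assume "p \<in> ?L"
    then obtain X Y where XY: "(X, Y) \<in> S" "fst p \<in> psl_conj M X" "snd p \<in> psl_conj N Y" by auto
    then obtain A B where "A \<in> X" "B \<in> Y" "p = \<Phi> (A, B)"
      unfolding psl_conj_def matrix_inv_SL2[OF assms(1)] matrix_inv_SL2[OF assms(2)] \<Phi>_def
      by (auto simp: prod_eq_iff)
    then show "p \<in> ?R" using XY(1) by blast
  next
    fix p assume "p \<in> ?R"
    then obtain A B X Y where AB: "p = \<Phi> (A, B)" "(X, Y) \<in> S" "A \<in> X" "B \<in> Y" by blast
    have "M ** A ** adj2 M \<in> psl_conj M X" "N ** B ** adj2 N \<in> psl_conj N Y"
      unfolding psl_conj_def matrix_inv_SL2[OF assms(1)] matrix_inv_SL2[OF assms(2)] using AB(3,4) by blast+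
    moreover have "(psl_conj M X, psl_conj N Y) \<in> (\<lambda>(X, Y). (psl_conj M X, psl_conj N Y)) ` S"
      using AB(2) by (auto intro!: image_eqI[of _ _ "(X, Y)"])
    ultimately show "p \<in> ?L" unfolding AB(1) \<Phi>_def mem_Collect_eq prod.case by blast
  qed
  ultimately show ?thesis unfolding psl_discrete_def by simp
qed

lemma admissible_swap:
  assumes "admissible rL rR" shows "admissible rR rL"
proof -
  obtain sL sR \<Lambda> where s: "\<forall>g. sL g \<in> Gt \<and> sR g \<in> Gt \<and> covers (sL g) (rL g) \<and> covers (sR g) (rR g)"
    "\<forall>x y. \<exists>k::int. sL (x + y) = (\<lambda>a. sL x (sL y a) + 2*pi*k) \<and> sR (x + y) = (\<lambda>b. sR x (sR y b) + 2*pi*k)"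
    "ein_saturated \<Lambda>" "closed \<Lambda>" "achronal \<Lambda>" "generic \<Lambda>" "\<exists>p\<in>\<Lambda>. \<exists>q\<in>\<Lambda>. \<not> ein_eq p q"
    "\<forall>g. (\<lambda>(a, b). (sL g a, sR g b)) ` \<Lambda> = \<Lambda>"
    and fd: "faithful rL rR" "psl_discrete (rep_image rL rR)"
    using assms unfolding admissible_def by metis
  have "(\<lambda>(a, b). (sR g a, sL g b)) ` prod.swap ` \<Lambda> = prod.swap ` \<Lambda>" for g
  proof -
    have "(\<lambda>(a, b). (sR g a, sL g b)) ` prod.swap ` \<Lambda> = prod.swap ` (\<lambda>(a, b). (sL g a, sR g b)) ` \<Lambda>"
      unfolding image_image by (intro image_cong) auto
    then show ?thesis using s(8) by simp
  qed
  moreover have "\<exists>p\<in>prod.swap ` \<Lambda>. \<exists>q\<in>prod.swap ` \<Lambda>. \<not> ein_eq p q"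
  proof -
    obtain p q where "p \<in> \<Lambda>" "q \<in> \<Lambda>" "\<not> ein_eq p q" using s(7) by blast
    moreover from this have "\<not> ein_eq (prod.swap p) (prod.swap q)"
      by (auto simp: ein_eq_def prod_eq_iff)
    ultimately show ?thesis by blast
  qed
  moreover have "faithful rR rL" using fd(1) unfolding faithful_def inj_def by blast
  moreover have "rep_image rR rL = prod.swap ` rep_image rL rR"
    unfolding rep_image_def by force
  then have "psl_discrete (rep_image rR rL)" using psl_discrete_swap[OF fd(2)] by simp
  ultimately show ?thesis
    unfolding admissible_def using s(1,2) ein_saturated_swap[OF s(3)] closed_swap[OF s(4)]
      achronal_swap[OF s(5)] generic_swap[OF s(3,6)] by metis
qed

lemma admissibleE:
  assumes "admissible rL rR"
  obtains sL sR \<Lambda> p q where "\<And>g. sL g \<in> Gt" "\<And>g. sR g \<in> Gt"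
    "\<And>g A. A \<in> rL g \<Longrightarrow> lifts (sL g) A" "\<And>g A. A \<in> rR g \<Longrightarrow> lifts (sR g) A"
    "ein_saturated \<Lambda>" "closed \<Lambda>" "achronal \<Lambda>" "generic \<Lambda>" "p \<in> \<Lambda>" "q \<in> \<Lambda>" "\<not> ein_eq p q"
    "\<And>g. preserves (sL g) (sR g) \<Lambda>"
proof -
  obtain sL sR \<Lambda> where s: "\<forall>g. sL g \<in> Gt \<and> sR g \<in> Gt \<and> covers (sL g) (rL g) \<and> covers (sR g) (rR g)"
    "ein_saturated \<Lambda>" "closed \<Lambda>" "achronal \<Lambda>" "generic \<Lambda>" "\<exists>p\<in>\<Lambda>. \<exists>q\<in>\<Lambda>. \<not> ein_eq p q"
    "\<forall>g. (\<lambda>(a, b). (sL g a, sR g b)) ` \<Lambda> = \<Lambda>"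
    using assms unfolding admissible_def by metis
  have "preserves (sL g) (sR g) \<Lambda>" for g
    unfolding preserves_def using s(7) by (metis (mono_tags, lifting) case_prod_conv image_eqI)
  moreover obtain p q where "p \<in> \<Lambda>" "q \<in> \<Lambda>" "\<not> ein_eq p q" using s(6) by blast
  ultimately show thesis using that[of sL sR \<Lambda> p q] s(1-5) covers_imp_lifts by blast
qed

lemma psl_self: "A \<in> psl A" by (simp add: psl_def)

text \<open>If \<open>A\<close> had no eigendirection, neither would its partner \<open>B\<close>,
  by \<open>eigendir_transfer\<close> with the factors exchanged, and both would be
  elliptic.\<close>

lemma admissible_eigendir:
  fixes rL rR :: "'g::ab_group_add \<Rightarrow> mat2 set"
  assumes "torsion_free TYPE('g)" "psl_hom rL" "psl_hom rR" "admissible rL rR"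
    and A: "A \<in> SL2" "rL g = psl A"
  shows "eigendir A"
proof (rule ccontr)
  assume nA: "\<not> eigendir A"
  obtain B where B: "B \<in> SL2" "rR g = psl B" using psl_hom_rep[OF assms(3)] .
  obtain sL sR \<Lambda> p q where s: "\<And>g. sL g \<in> Gt" "\<And>g. sR g \<in> Gt"
    "\<And>g A. A \<in> rL g \<Longrightarrow> lifts (sL g) A" "\<And>g A. A \<in> rR g \<Longrightarrow> lifts (sR g) A"
    "ein_saturated \<Lambda>" "closed \<Lambda>" "achronal \<Lambda>" "generic \<Lambda>" "p \<in> \<Lambda>" "q \<in> \<Lambda>" "\<not> ein_eq p q"
    "\<And>g. preserves (sL g) (sR g) \<Lambda>"
    using admissibleE[OF assms(4)] by blast
  have "\<not> eigendir B"
    using eigendir_transfer[OF ein_saturated_swap[OF s(5)] achronal_swap[OF s(7)] _ preserves_swap[OF s(12)] s(2,1) B(1)]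
      s(3,4,9) A B psl_self nA by blast
  moreover have "faithful rL rR" "psl_discrete (rep_image rL rR)" using assms(4) by (simp_all add: admissible_def)
  ultimately show False
    using not_both_elliptic[OF assms(1-3)] A B nA not_eigendir_trace by blast
qed

lemma dir_preimage:
  assumes "M \<in> SL2" "v \<noteq> 0" obtains x c where "c \<noteq> 0" "M *v dir x = c *\<^sub>R v"
proof -
  obtain c x where c: "c \<noteq> 0" "adj2 M *v v = c *\<^sub>R dir x"
    using dir_exists[OF mult_vec_SL2_nonzero[OF SL2_adj2[OF assms(1)] assms(2)]] by metis
  have "v = M *v (c *\<^sub>R dir x)"
    unfolding c(2)[symmetric] by (simp add: matrix_vector_mul_assoc adj2_mult(2)[OF assms(1)])
  then have "M *v dir x = (1 / c) *\<^sub>R v" using c(1) by (simp add: matrix_vector_mult_scaleR)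
  then show thesis using that[of "1 / c" x] c(1) by simp
qed

lemma cross_conj:
  assumes "M \<in> SL2"
  shows "cross (dir x) ((adj2 M ** E ** M) *v dir x) = cross (M *v dir x) (E *v (M *v dir x))"
proof -
  have "cross (M *v u) (M *v v) = cross u v" for u v
    using assms by (simp add: cross_mult SL2_def)
  then show ?thesis by (metis adj2_conj_vector[OF assms])
qed

text \<open>With parameters of opposite sign, \<open>g\<close> pushes the two coordinates in
  opposite directions and \<open>- g\<close> reverses both pushes, which is the configuration
  refuted by \<open>opposite_moves_False\<close>.\<close>

lemma parabolic_same_direction:
  fixes rL rR :: "'g::ab_group_add \<Rightarrow> mat2 set"
  assumes adm: "admissible rL rR" and M: "M \<in> SL2" and N: "N \<in> SL2"
    and L: "rL g = psl (adj2 M ** exp_H a ** M)" "rL (- g) = psl (adj2 M ** exp_H (- a) ** M)"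
    and R: "rR g = psl (adj2 N ** exp_H b ** N)" "rR (- g) = psl (adj2 N ** exp_H (- b) ** N)"
  shows "a * b \<ge> 0"
proof (rule ccontr)
  assume neg: "\<not> ?thesis"
  obtain sL sR \<Lambda> p q where s: "\<And>g. sL g \<in> Gt" "\<And>g. sR g \<in> Gt"
    "\<And>g A. A \<in> rL g \<Longrightarrow> lifts (sL g) A" "\<And>g A. A \<in> rR g \<Longrightarrow> lifts (sR g) A"
    "ein_saturated \<Lambda>" "closed \<Lambda>" "achronal \<Lambda>" "generic \<Lambda>" "p \<in> \<Lambda>" "q \<in> \<Lambda>" "\<not> ein_eq p q"
    "\<And>g. preserves (sL g) (sR g) \<Lambda>"
    using admissibleE[OF adm] by blast
  have e1: "vec2 1 0 \<noteq> 0" by (simp add: vec2_eq_iff)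
  obtain x c where x: "c \<noteq> 0" "M *v dir x = c *\<^sub>R vec2 1 0" using dir_preimage[OF M e1] .
  obtain y d where y: "d \<noteq> 0" "N *v dir y = d *\<^sub>R vec2 1 0" using dir_preimage[OF N e1] .
  have move: "\<exists>f h. preserves f h \<Lambda> \<and> moves f x (- sgn a') \<and> moves h y (- sgn b')"
    if "rL g' = psl (adj2 M ** exp_H a' ** M)" "rR g' = psl (adj2 N ** exp_H b' ** N)" "a' \<noteq> 0" "b' \<noteq> 0" for g' a' b'
  proof -
    let ?A = "adj2 M ** exp_H a' ** M" and ?B = "adj2 N ** exp_H b' ** N"
    have "cross (dir x) (?A *v dir x) = 0"
      unfolding cross_conj[OF M] x(2) exp_H_vector by (simp add: cross_def)
    moreover have "lifts (sL g') ?A" "lifts (sR g') ?B" using s(3,4) that(1,2) psl_self by auto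
    ultimately obtain f h where f: "f \<in> Gt" "h \<in> Gt" "lifts f ?A" "lifts h ?B" "preserves f h \<Lambda>" "f x = x"
      using normalize_lift[OF s(5) s(12)[of g'] s(1,2) SL2_conj[OF M SL2_exp_H]] by metis
    \<comment> \<open>The common translation was already used up by \<open>f\<close>; the fixed
      point of \<open>h\<close> comes from \<Lambda>.\<close>
    obtain z where "h z = z"
      using fixed_point_transfer[OF s(5,7) _ f(5,1,2,6), of "fst p" "snd p"] s(9) by auto
    then have "moves h y (- sgn b')"
      using moves_of_parabolic[OF N f(2,4) _ that(4)] y by simp
    moreover have "moves f x (- sgn a')"
      using moves_of_parabolic[OF M f(1,3,6) that(3)] x by simp
    ultimately show ?thesis using f(5) by blast
  qed
  have ab: "a \<noteq> 0" "b \<noteq> 0" using neg by auto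
  have sg: "- sgn b = - (- sgn a)" using neg ab by (auto simp: sgn_if zero_le_mult_iff not_le)
  obtain f h where f: "preserves f h \<Lambda>" "moves f x (- sgn a)" "moves h y (- (- sgn a))"
    using move[OF L(1) R(1)] ab sg by metis
  obtain f' h' where f': "preserves f' h' \<Lambda>" "moves f' x (- (- sgn a))" "moves h' y (- sgn a)"
    using move[OF L(2) R(2)] ab sg by (auto simp: sgn_minus)
  have "- sgn a = 1 \<or> - sgn a = -1" using ab by (simp add: sgn_if)
  then show False using opposite_moves_False[OF s(5-11) f(1) f'(1) f(2,3) f'(2,3)] by blast
qed

text \<open>If the two pairs were independent, the form would be a product of independent linear
  factors and so negative somewhere. Negativity is an open condition, hence holds at a rational
  ratio, and clearing the denominator gives integers.\<close>

lemma quadratic_int_nonneg: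
  fixes a a' b b' :: real
  assumes "\<And>(m::int) (n::int). (m * a + n * a') * (m * b + n * b') \<ge> 0"
  shows "a * b' = a' * b"
proof (rule ccontr)
  assume ne: "a * b' \<noteq> a' * b"
  define \<phi> where "\<phi> = (\<lambda>x. (x * a + a') * (x * b + b'))"
  obtain x where x: "\<phi> x < 0"
  proof (cases "a * b = 0")
    case True
    \<comment> \<open>Now \<phi> is affine with slope \<open>s\<close>, which is nonzero by
      \<open>ne\<close>; the point chosen below has value -1.\<close>
    define s where "s = a * b' + a' * b"
    have s: "s \<noteq> 0" using ne True by (auto simp: s_def)
    have "\<phi> x = x * s + a' * b'" for x
      using True by (auto simp: \<phi>_def s_def algebra_simps)
    then have "\<phi> (- (a' * b' + 1) / s) < 0" using s by simp
    then show thesis using that by blast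
  next
    case False
    have "a * b \<ge> 0" using assms[of 1 0] by simp
    then have ab: "a * b > 0" using False by linarith
    \<comment> \<open>The vertex of the parabola: completing the square leaves minus the squared
      determinant of the two pairs.\<close>
    let ?x = "- (a * b' + a' * b) / (2 * (a * b))"
    have "4 * (a * b) * \<phi> ?x = (2 * (a * b) * ?x + (a * b' + a' * b))\<^sup>2 - (a * b' - a' * b)\<^sup>2"
      unfolding \<phi>_def by (simp add: power2_eq_square algebra_simps del: times_divide_eq_left times_divide_eq_right)
    also have "\<dots> = - (a * b' - a' * b)\<^sup>2" using False by simp
    also have "\<dots> < 0" using ne by simp
    finally have "4 * (a * b) * \<phi> ?x < 0" .
    moreover have "4 * (a * b) > 0" using ab by simp
    ultimately have "\<phi> ?x < 0" using mult_nonneg_nonneg[OF less_imp_le] not_le by metis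
    then show thesis using that by blast
  qed
  have "open {x. \<phi> x < 0}" unfolding \<phi>_def by (intro open_Collect_less continuous_intros)
  then obtain e where e: "e > 0" "ball x e \<subseteq> {x. \<phi> x < 0}" using x open_contains_ball by blast
  obtain r where r: "x < of_rat r" "of_rat r < x + e" using of_rat_dense[of x "x + e"] e(1) by auto
  then have "of_rat r \<in> ball x e" by (simp add: dist_real_def)
  then have "\<phi> (of_rat r) < 0" using e(2) by blast
  obtain m n :: int where mn: "r = Fract m n" "n > 0" by (cases r) auto
  then have q: "of_rat r = real_of_int m / of_int n" by (simp add: of_rat_rat)
  have "(m * a + n * a') * (m * b + n * b') = (of_int n)\<^sup>2 * \<phi> (of_rat r)"
    unfolding \<phi>_def q using mn(2) by (simp add: field_simps power2_eq_square)
  then have "(m * a + n * a') * (m * b + n * b') < 0"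
    using \<open>\<phi> (of_rat r) < 0\<close> mn(2) by (simp add: mult_pos_neg)
  then show False using assms[of m n] by linarith
qed

section \<open>From admissibility to the standard forms\<close>

definition in_standard_form :: "('g \<Rightarrow> mat2 set) \<Rightarrow> ('g \<Rightarrow> mat2 set) \<Rightarrow> bool" where
  "in_standard_form rL rR \<longleftrightarrow>
    (\<exists>M\<in>SL2. \<exists>N\<in>SL2. \<exists>sw::bool.
       (let S = (if sw then prod.swap else id) `
                  {(psl_conj M (rL g), psl_conj N (rR g)) | g. True}
        in psl_discrete S \<and> (S \<subseteq> A_hyp \<or> S \<subseteq> A_ext \<or> S \<subseteq> A_par)))"

lemma conj_image_eq:
  "{(psl_conj M (rL g), psl_conj N (rR g)) | g. True}
    = (\<lambda>(X, Y). (psl_conj M X, psl_conj N Y)) ` rep_image rL rR"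
  by (auto simp: rep_image_def image_image)

lemma in_standard_formI:
  assumes "M \<in> SL2" "N \<in> SL2" "psl_discrete (rep_image rL rR)" "T \<in> {A_hyp, A_ext, A_par}"
    and "\<And>g. (psl_conj M (rL g), psl_conj N (rR g)) \<in> T"
  shows "in_standard_form rL rR"
proof -
  let ?S = "{(psl_conj M (rL g), psl_conj N (rR g)) | g. True}"
  have "psl_discrete ?S" unfolding conj_image_eq using psl_discrete_conj assms(1-3) by blast
  moreover have "?S \<subseteq> T" using assms(5) by blast
  ultimately show ?thesis
    unfolding in_standard_form_def Let_def using assms(1,2,4)
    by (intro bexI[of _ M] bexI[of _ N] exI[of _ False]) auto
qed

lemma in_standard_form_swapI:
  assumes "M \<in> SL2" "N \<in> SL2" "psl_discrete (rep_image rL rR)" "T \<in> {A_hyp, A_ext, A_par}"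
    and "\<And>g. (psl_conj N (rR g), psl_conj M (rL g)) \<in> T"
  shows "in_standard_form rL rR"
proof -
  let ?S = "{(psl_conj M (rL g), psl_conj N (rR g)) | g. True}"
  have "psl_discrete (prod.swap ` ?S)"
    unfolding conj_image_eq using psl_discrete_conj psl_discrete_swap assms(1-3) by blast
  moreover have "prod.swap ` ?S \<subseteq> T" using assms(5) by auto
  ultimately show ?thesis
    unfolding in_standard_form_def Let_def using assms(1,2,4)
    by (intro bexI[of _ M] bexI[of _ N] exI[of _ True]) auto
qed

lemma psl_conj_conj: "M \<in> SL2 \<Longrightarrow> psl_conj M (psl (adj2 M ** E ** M)) = psl E"
  using psl_conj_eq_psl_iff by blast

lemma conj_mult:
  assumes "P \<in> SL2"
  shows "(adj2 P ** X ** P) ** (adj2 P ** Y ** P) = adj2 P ** (X ** Y) ** P"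
proof -
  have "(adj2 P ** X ** P) ** (adj2 P ** Y ** P) = adj2 P ** X ** (P ** adj2 P) ** Y ** P"
    by (simp only: matrix_mul_assoc)
  also have "\<dots> = adj2 P ** (X ** Y) ** P"
    unfolding adj2_mult(2)[OF assms] matrix_mul_rid by (simp only: matrix_mul_assoc)
  finally show ?thesis .
qed

lemma psl_exp_H_inj: "psl (exp_H a) = psl (exp_H b) \<Longrightarrow> a = b"
  by (auto simp: psl_eq_iff exp_H_def mat2_eq_iff)

lemma exp_H_add: "exp_H a ** exp_H b = exp_H (a + b)"
  by (simp add: mat2_eq_iff matrix_mult_nth2 exp_H_def)

text \<open>Diagonal conjugation rescales the unipotent parameter by exp (2 s). Applied to one
  factor alone, it adjusts the ratio of the two parameters by any positive number.\<close>

lemma conj_exp_Delta_exp_H: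
  "adj2 (exp_Delta s ** N) ** exp_H (exp (2 * s) * b) ** (exp_Delta s ** N) = adj2 N ** exp_H b ** N"
proof -
  have "adj2 (exp_Delta s) ** exp_H (exp (2 * s) * b) ** exp_Delta s = exp_H b"
    by (simp add: mat2_eq_iff matrix_mult_nth2 exp_H_def exp_Delta_def adj2_def flip: exp_add)
  moreover have "adj2 (exp_Delta s ** N) ** exp_H (exp (2 * s) * b) ** (exp_Delta s ** N)
      = adj2 N ** (adj2 (exp_Delta s) ** exp_H (exp (2 * s) * b) ** exp_Delta s) ** N"
    by (simp only: adj2_compose matrix_mul_assoc)
  ultimately show ?thesis by simp
qed

text \<open>The parameters are additive and their product is nonnegative on every integral
  combination, so all pairs lie on one line. If the line is an axis, the group lies in
  \<open>A_ext\<close>, possibly after exchange; otherwise the slope is positive and can be rescaled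
  to 1.\<close>

lemma parabolic_pair_standard_form:
  fixes rL rR :: "'g::ab_group_add \<Rightarrow> mat2 set"
  assumes hom: "psl_hom rL" "psl_hom rR" and adm: "admissible rL rR"
    and M: "M \<in> SL2" "\<And>g. \<exists>e. rL g = psl (adj2 M ** exp_H e ** M)"
    and N: "N \<in> SL2" "\<And>g. \<exists>e. rR g = psl (adj2 N ** exp_H e ** N)"
  shows "in_standard_form rL rR"
proof -
  obtain a where a: "\<And>g. rL g = psl (adj2 M ** exp_H (a g) ** M)" using M(2) by metis
  obtain b where b: "\<And>g. rR g = psl (adj2 N ** exp_H (b g) ** N)" using N(2) by metis
  have add: "c (x + y) = c x + c y"
    if r: "psl_hom r" and P: "P \<in> SL2" and c: "\<And>g. r g = psl (adj2 P ** exp_H (c g) ** P)"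
    for r :: "'g \<Rightarrow> mat2 set" and P c x y
  proof -
    have "r (x + y) = psl_mult (r x) (r y)" using r by (simp add: psl_hom_def)
    also have "\<dots> = psl (adj2 P ** exp_H (c x) ** P ** (adj2 P ** exp_H (c y) ** P))" by (simp add: c psl_mult_psl)
    also have "adj2 P ** exp_H (c x) ** P ** (adj2 P ** exp_H (c y) ** P) = adj2 P ** (exp_H (c x) ** exp_H (c y)) ** P"
      by (rule conj_mult[OF P])
    finally have "psl_conj P (r (x + y)) = psl_conj P (psl (adj2 P ** exp_H (c x + c y) ** P))" by (simp add: exp_H_add)
    then have "psl (exp_H (c (x + y))) = psl (exp_H (c x + c y))" by (simp add: c psl_conj_conj[OF P])
    then show ?thesis by (rule psl_exp_H_inj)
  qed
  note adda = add[OF hom(1) M(1) a] and addb = add[OF hom(2) N(1) b]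
  have inv: "c (- x) = - c x" if "\<And>x y. c (x + y) = c x + c y" for c :: "'g \<Rightarrow> real" and x
    using that[of x "- x"] that[of 0 0] by simp
  have pos: "a g * b g \<ge> 0" for g
    by (rule parabolic_same_direction[OF adm M(1) N(1), of g])
       (simp_all add: a b flip: inv[of a, OF adda] inv[of b, OF addb])
  \<comment> \<open>The integral combinations must be realised by elements of the group, since
    nonnegativity is known only there.\<close>
  have mult: "\<exists>z. a z = of_int m * a x \<and> b z = of_int m * b x" for m :: int and x
  proof (induction m rule: int_induct[of _ 0])
    case base
    then show ?case using adda[of 0 0] addb[of 0 0] by (intro exI[of _ 0]) simp
  next
    case (step1 i)
    then obtain z where "a z = of_int i * a x" "b z = of_int i * b x" by blast
    then show ?case by (intro exI[of _ "z + x"]) (simp add: adda addb algebra_simps)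
  next
    case (step2 i)
    then obtain z where "a z = of_int i * a x" "b z = of_int i * b x" by blast
    moreover have "a (z + - x) = a z - a x" "b (z + - x) = b z - b x"
      unfolding adda addb inv[of a, OF adda] inv[of b, OF addb] by simp_all
    ultimately show ?case by (intro exI[of _ "z + - x"]) (simp add: left_diff_distrib)
  qed
  have form: "(of_int m * a x + of_int n * a y) * (of_int m * b x + of_int n * b y) \<ge> 0" for m n :: int and x y
  proof -
    obtain z w where "a z = of_int m * a x" "b z = of_int m * b x" "a w = of_int n * a y" "b w = of_int n * b y"
      using mult by metis
    then show ?thesis using pos[of "z + w"] by (simp add: adda addb)
  qed
  have line: "a x * b y = a y * b x" for x y
    by (rule quadratic_int_nonneg) (rule form)
  have disc: "psl_discrete (rep_image rL rR)" using adm by (simp add: admissible_def)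
  have cL: "psl_conj M (rL g) = psl (exp_H (a g))" for g by (simp add: a psl_conj_conj[OF M(1)])
  have cR: "psl_conj N (rR g) = psl (exp_H (b g))" for g by (simp add: b psl_conj_conj[OF N(1)])
  consider "\<forall>g. a g = 0" | "\<forall>g. b g = 0" | g where "a g * b g > 0"
  proof (cases "\<forall>g. a g = 0")
    case False
    then obtain g where g: "a g \<noteq> 0" by blast
    show thesis
    proof (cases "b g = 0")
      case True
      then have "b y = 0" for y using line[of g y] g by simp
      then show thesis using that by blast
    next
      case False
      then have "a g * b g > 0" using pos[of g] g by (metis mult_eq_0_iff order_le_less)
      then show thesis using that by blast
    qed
  qed (use that in blast)
  then show ?thesis
  proof cases
    case 1
    \<comment> \<open>The trivial left factor is read as the diagonal matrix with \<lambda> =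
      0.\<close>
    have "(psl_conj M (rL g), psl_conj N (rR g)) \<in> A_ext" for g
      unfolding A_ext_def cL cR using 1 exp_Delta_0 exp_H_0 by (metis (mono_tags, lifting) mem_Collect_eq)
    then show ?thesis using in_standard_formI[OF M(1) N(1) disc] by blast
  next
    case 2
    have "(psl_conj N (rR g), psl_conj M (rL g)) \<in> A_ext" for g
      unfolding A_ext_def cL cR using 2 exp_Delta_0 exp_H_0 by (metis (mono_tags, lifting) mem_Collect_eq)
    then show ?thesis using in_standard_form_swapI[OF M(1) N(1) disc] by blast
  next
    case (3 g)
    define k where "k = b g / a g"
    have k: "k > 0" using 3 by (auto simp: k_def zero_less_mult_iff zero_less_divide_iff)
    have bk: "b x = k * a x" for x
    proof -
      have "a g \<noteq> 0" using 3 by auto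
      then show ?thesis using line[of g x] by (simp add: k_def field_simps)
    qed
    \<comment> \<open>Chosen so that exp (2 s) = 1 / k, which cancels the slope.\<close>
    define s where "s = - ln k / 2"
    let ?N = "exp_Delta s ** N"
    have N': "?N \<in> SL2" using SL2_mult SL2_exp_Delta N(1) by blast
    have "exp (2 * s) * b x = a x" for x using k by (simp add: bk s_def exp_minus)
    then have "rR x = psl (adj2 ?N ** exp_H (a x) ** ?N)" for x
      using b[of x] conj_exp_Delta_exp_H[of s N "b x"] by simp
    then have "psl_conj ?N (rR x) = psl (exp_H (a x))" for x by (simp add: psl_conj_conj[OF N'])
    then have "(psl_conj M (rL x), psl_conj ?N (rR x)) \<in> A_par" for x
      unfolding A_par_def cL by blast
    then show ?thesis using in_standard_formI[OF M(1) N' disc] by blast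
  qed
qed

text \<open>Each factor is separately diagonal or unipotent. The two mixed cases differ by an
  exchange of factors; only the doubly unipotent case needs more of the geometry of
  \<Lambda>.\<close>

lemma admissible_imp_standard_form:
  fixes rL rR :: "'g::ab_group_add \<Rightarrow> mat2 set"
  assumes tf: "torsion_free TYPE('g)" and hom: "psl_hom rL" "psl_hom rR" and adm: "admissible rL rR"
  shows "in_standard_form rL rR"
proof -
  have disc: "psl_discrete (rep_image rL rR)" using adm by (simp add: admissible_def)
  obtain M where M: "M \<in> SL2"
    "(\<forall>g. \<exists>l. rL g = psl (adj2 M ** exp_Delta l ** M)) \<or> (\<forall>g. \<exists>e. rL g = psl (adj2 M ** exp_H e ** M))"
    using abelian_conj[OF hom(1) admissible_eigendir[OF tf hom adm]] .
  obtain N where N: "N \<in> SL2"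
    "(\<forall>g. \<exists>l. rR g = psl (adj2 N ** exp_Delta l ** N)) \<or> (\<forall>g. \<exists>e. rR g = psl (adj2 N ** exp_H e ** N))"
    using abelian_conj[OF hom(2) admissible_eigendir[OF tf hom(2,1) admissible_swap[OF adm]]] .
  have c: "\<exists>l. psl_conj P X = psl (F l)" if "P \<in> SL2" "\<exists>l. X = psl (adj2 P ** F l ** P)"
    for P X and F :: "real \<Rightarrow> mat2"
    using that psl_conj_conj by blast
  show ?thesis
    using M(2) N(2)
  proof (elim disjE)
    assume L: "\<forall>g. \<exists>l. rL g = psl (adj2 M ** exp_Delta l ** M)" and R: "\<forall>g. \<exists>l. rR g = psl (adj2 N ** exp_Delta l ** N)"
    have "(psl_conj M (rL g), psl_conj N (rR g)) \<in> A_hyp" for g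
      using c[OF M(1) L[rule_format, of g]] c[OF N(1) R[rule_format, of g]] unfolding A_hyp_def by auto
    then show ?thesis using in_standard_formI[OF M(1) N(1) disc] by blast
  next
    assume L: "\<forall>g. \<exists>l. rL g = psl (adj2 M ** exp_Delta l ** M)" and R: "\<forall>g. \<exists>l. rR g = psl (adj2 N ** exp_H l ** N)"
    have "(psl_conj M (rL g), psl_conj N (rR g)) \<in> A_ext" for g
      using c[OF M(1) L[rule_format, of g]] c[OF N(1) R[rule_format, of g]] unfolding A_ext_def by auto
    then show ?thesis using in_standard_formI[OF M(1) N(1) disc] by blast
  next
    assume L: "\<forall>g. \<exists>l. rL g = psl (adj2 M ** exp_H l ** M)" and R: "\<forall>g. \<exists>l. rR g = psl (adj2 N ** exp_Delta l ** N)"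
    have "(psl_conj N (rR g), psl_conj M (rL g)) \<in> A_ext" for g
      using c[OF M(1) L[rule_format, of g]] c[OF N(1) R[rule_format, of g]] unfolding A_ext_def by auto
    then show ?thesis using in_standard_form_swapI[OF M(1) N(1) disc] by blast
  next
    assume "\<forall>g. \<exists>l. rL g = psl (adj2 M ** exp_H l ** M)" "\<forall>g. \<exists>l. rR g = psl (adj2 N ** exp_H l ** N)"
    then show ?thesis using parabolic_pair_standard_form[OF hom adm M(1) _ N(1)] by blast
  qed
qed

section \<open>From the standard forms to admissibility\<close>

text \<open>The lift of a sum and the composite of the lifts cover the same product and both fix
  \<open>x\<close>, so \<open>lifts_eq_if_agree\<close> identifies them.\<close>

lemma fixed_point_lifts:
  fixes r :: "'g::ab_group_add \<Rightarrow> mat2 set"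
  assumes r: "psl_hom r" and fx: "\<And>g. \<exists>A\<in>SL2. r g = psl A \<and> cross (dir x) (A *v dir x) = 0"
  obtains s where "\<And>g. s g \<in> Gt" "\<And>g. covers (s g) (r g)" "\<And>g. s g x = x"
    "\<And>g h. s (g + h) = (\<lambda>a. s g (s h a))"
proof -
  have "\<exists>f. f \<in> Gt \<and> covers f (r g) \<and> f x = x" for g
  proof -
    obtain A where A: "A \<in> SL2" "r g = psl A" "cross (dir x) (A *v dir x) = 0" using fx by blast
    obtain f where "f \<in> Gt" "lifts f A" "f x = x" using lift_exists[OF A(1,3)] .
    then show ?thesis using A covers_psl by auto
  qed
  then obtain s where s: "\<And>g. s g \<in> Gt" "\<And>g. covers (s g) (r g)" "\<And>g. s g x = x" by metis
  have "s (g + h) = (\<lambda>a. s g (s h a))" for g h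
  proof -
    obtain A where A: "A \<in> SL2" "r g = psl A" using psl_hom_rep[OF r] .
    obtain B where B: "B \<in> SL2" "r h = psl B" using psl_hom_rep[OF r] .
    have "r (g + h) = psl (A ** B)" using r by (simp add: psl_hom_def A B psl_mult_psl)
    then have "lifts (s (g + h)) (A ** B)" using s(2)[of "g + h"] covers_psl SL2_mult A(1) B(1) by metis
    moreover have "lifts (\<lambda>a. s g (s h a)) (A ** B)"
      using lifts_compose s(2)[of g] s(2)[of h] A B covers_psl by metis
    moreover have "continuous_on UNIV (\<lambda>a. s g (s h a))"
      using continuous_on_compose2[OF Gt_continuous[OF s(1)] Gt_continuous[OF s(1)]] by blast
    moreover have "s (g + h) x = s g (s h x)" using s(3) by simp
    ultimately show ?thesis
      using lifts_eq_if_agree[OF Gt_continuous[OF s(1)] _ SL2_mult[OF A(1) B(1)]] by blast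
  qed
  then show thesis using that s by blast
qed

text \<open>For exact homomorphisms the central integer is 0. The lift of 0 is idempotent and
  injective, hence the identity, so lifts of negatives are inverses and forward invariance becomes
  equality.\<close>

lemma admissibleI:
  fixes rL rR :: "'g::ab_group_add \<Rightarrow> mat2 set"
  assumes "faithful rL rR" "psl_discrete (rep_image rL rR)"
    and L: "\<And>g. sL g \<in> Gt" "\<And>g. covers (sL g) (rL g)" "\<And>g h. sL (g + h) = (\<lambda>a. sL g (sL h a))"
    and R: "\<And>g. sR g \<in> Gt" "\<And>g. covers (sR g) (rR g)" "\<And>g h. sR (g + h) = (\<lambda>a. sR g (sR h a))"
    and \<Lambda>: "ein_saturated \<Lambda>" "closed \<Lambda>" "achronal \<Lambda>" "generic \<Lambda>" "p \<in> \<Lambda>" "q \<in> \<Lambda>" "\<not> ein_eq p q"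
    and pres: "\<And>g. preserves (sL g) (sR g) \<Lambda>"
  shows "admissible rL rR"
proof -
  have zero: "s 0 a = a" if "\<And>g. s g \<in> Gt" "\<And>g h. s (g + h) = (\<lambda>a. s g (s h a))"
    for s :: "'g \<Rightarrow> real \<Rightarrow> real" and a
    using fun_cong[OF that(2)[of 0 0], of a] strict_mono_eq[OF Gt_strict_mono[OF that(1)[of 0]]] by simp
  have inv: "s g (s (- g) a) = a" if "\<And>g. s g \<in> Gt" "\<And>g h. s (g + h) = (\<lambda>a. s g (s h a))"
    for s :: "'g \<Rightarrow> real \<Rightarrow> real" and g a
    using fun_cong[OF that(2)[of g "- g"], of a] zero[OF that] by simp
  have img: "(\<lambda>(a, b). (sL g a, sR g b)) ` \<Lambda> = \<Lambda>" for g
  proof (intro equalityI subsetI)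
    fix z assume "z \<in> (\<lambda>(a, b). (sL g a, sR g b)) ` \<Lambda>"
    then show "z \<in> \<Lambda>" using pres by (auto simp: preserves_def)
  next
    fix z assume z: "z \<in> \<Lambda>"
    let ?w = "(sL (- g) (fst z), sR (- g) (snd z))"
    have "?w \<in> \<Lambda>" using pres[of "- g"] z by (simp add: preserves_def)
    moreover have "z = (\<lambda>(a, b). (sL g a, sR g b)) ?w" using inv[OF L(1,3)] inv[OF R(1,3)] by simp
    ultimately show "z \<in> (\<lambda>(a, b). (sL g a, sR g b)) ` \<Lambda>" by (rule rev_image_eqI)
  qed
  have hom: "\<exists>k::int. sL (x + y) = (\<lambda>a. sL x (sL y a) + 2 * pi * k) \<and> sR (x + y) = (\<lambda>b. sR x (sR y b) + 2 * pi * k)" for x y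
    using L(3) R(3) by (intro exI[of _ 0]) simp
  have two: "\<exists>p\<in>\<Lambda>. \<exists>q\<in>\<Lambda>. \<not> ein_eq p q" using \<Lambda>(5-7) by blast
  show ?thesis
    unfolding admissible_def
    by (intro conjI assms(1,2) exI[of _ sL] exI[of _ sR] exI[of _ \<Lambda>] allI L(1,2) R(1,2) \<Lambda>(1-4) img hom two)
qed

lemma ein_saturatedI:
  assumes "\<And>a b (k::int). (a, b) \<in> \<Lambda> \<Longrightarrow> (a + 2 * pi * k, b + 2 * pi * k) \<in> \<Lambda>"
  shows "ein_saturated \<Lambda>"
  using assms by (auto simp: ein_saturated_def)

text \<open>The points (x, y) and (x', y) share a null coordinate, so they are not chronologically
  related. Their first coordinates differ by less than a period, which keeps all diagonal translates
  achronal and generic.\<close>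

lemma admissible_of_fixed_points:
  fixes rL rR :: "'g::ab_group_add \<Rightarrow> mat2 set"
  assumes hom: "psl_hom rL" "psl_hom rR" and fd: "faithful rL rR" "psl_discrete (rep_image rL rR)"
    and x: "\<And>g. \<exists>A\<in>SL2. rL g = psl A \<and> cross (dir x) (A *v dir x) = 0 \<and> cross (dir x') (A *v dir x') = 0"
    and xx: "x < x'" "x' < x + 2 * pi"
    and y: "\<And>g. \<exists>A\<in>SL2. rR g = psl A \<and> cross (dir y) (A *v dir y) = 0"
  shows "admissible rL rR"
proof -
  obtain sL where L: "\<And>g. sL g \<in> Gt" "\<And>g. covers (sL g) (rL g)" "\<And>g. sL g x = x"
    "\<And>g h. sL (g + h) = (\<lambda>a. sL g (sL h a))"
    using fixed_point_lifts[OF hom(1), of x] x by metis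
  obtain sR where R: "\<And>g. sR g \<in> Gt" "\<And>g. covers (sR g) (rR g)" "\<And>g. sR g y = y"
    "\<And>g h. sR (g + h) = (\<lambda>a. sR g (sR h a))"
    using fixed_point_lifts[OF hom(2) y] by metis
  \<comment> \<open>The lift was normalised at \<open>x\<close> only. At \<open>x'\<close> it can be
    off by a multiple of 2 pi, but monotonicity keeps its value between \<open>x\<close> and x + 2
    pi, so the multiple is 0.\<close>
  have L': "sL g x' = x'" for g
  proof -
    obtain A where A: "A \<in> SL2" "rL g = psl A" "cross (dir x') (A *v dir x') = 0" using x by blast
    obtain f where f: "f \<in> Gt" "lifts f A" "f x' = x'" using lift_exists[OF A(1,3)] .
    have "lifts (sL g) A" using L(2)[of g] A covers_psl by metis
    then obtain k :: int where k: "\<And>t. sL g t = f t + 2 * pi * k"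
      using lifts_unique[OF Gt_continuous[OF f(1)] Gt_continuous[OF L(1)] A(1) f(2)] by metis
    have "x < sL g x'" "sL g x' < x + 2 * pi"
      using Gt_mono_local[OF L(1) xx, of g] L(3) by simp_all
    then have "\<bar>2 * pi * k\<bar> < 2 * pi * 1" using k[of x'] f(3) xx by linarith
    then have "2 * pi * \<bar>real_of_int k\<bar> < 2 * pi * 1" by (simp add: abs_mult)
    then have "\<bar>real_of_int k\<bar> < 1" by (simp only: mult_less_cancel_left_pos pi_gt_zero mult_pos_pos zero_less_numeral)
    then have "k = 0" by linarith
    then show ?thesis using k[of x'] f(3) by simp
  qed
  \<comment> \<open>The sine encodes membership in y + 2 pi Z by an equation between continuous
    functions, which makes closedness immediate.\<close>
  define \<Lambda> where "\<Lambda> = {p. sin ((snd p - y) / 2) = 0 \<and> (fst p - x = snd p - y \<or> fst p - x' = snd p - y)}"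
  have mem: "(a, b) \<in> \<Lambda> \<longleftrightarrow> (\<exists>k::int. b = y + 2 * pi * k \<and> (a = x + 2 * pi * k \<or> a = x' + 2 * pi * k))" for a b
    unfolding \<Lambda>_def mem_Collect_eq fst_conv snd_conv sin_half_eq_0 by (auto simp: algebra_simps)
  have sat: "ein_saturated \<Lambda>"
  proof (rule ein_saturatedI)
    fix a b and k :: int assume "(a, b) \<in> \<Lambda>"
    then obtain j :: int where j: "b = y + 2 * pi * j" "a = x + 2 * pi * j \<or> a = x' + 2 * pi * j" using mem by blast
    show "(a + 2 * pi * k, b + 2 * pi * k) \<in> \<Lambda>"
      unfolding mem by (rule exI[of _ "j + k"]) (use j in \<open>auto simp: algebra_simps\<close>)
  qed
  show ?thesis
  proof (rule admissibleI[OF fd L(1,2,4) R(1,2,4) sat])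
    have "closed {p :: real \<times> real. sin ((snd p - y) / 2) = 0}"
      "closed {p :: real \<times> real. fst p - x = snd p - y}" "closed {p :: real \<times> real. fst p - x' = snd p - y}"
      by (intro closed_Collect_eq continuous_intros; simp)+
    then show "closed \<Lambda>" unfolding \<Lambda>_def by (intro closed_Collect_conj closed_Collect_disj)
    show "achronal \<Lambda>"
    proof (rule achronalI[OF sat])
      fix a b a' b' assume "(a, b) \<in> \<Lambda>" "(a', b') \<in> \<Lambda>" "a < a'"
      then obtain k k' :: int where k: "b = y + 2 * pi * k" "a = x + 2 * pi * k \<or> a = x' + 2 * pi * k"
        "b' = y + 2 * pi * k'" "a' = x + 2 * pi * k' \<or> a' = x' + 2 * pi * k'" using mem by metis
      have "k \<le> k'"
      proof (rule ccontr)
        assume "\<not> ?thesis"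
        then have "real_of_int k' + 1 \<le> of_int k" by linarith
        then have "2 * pi * (real_of_int k' + 1) \<le> 2 * pi * of_int k" by (intro mult_left_mono) auto
        then have "2 * pi * real_of_int k' + 2 * pi \<le> 2 * pi * of_int k" by (simp add: algebra_simps)
        then show False using k(2,4) xx \<open>a < a'\<close> by auto
      qed
      then show "b \<le> b'" using k(1,3) by simp
    qed
    show "generic \<Lambda>"
      unfolding generic_def
    proof (intro ballI notI)
      fix p assume p: "p \<in> \<Lambda>" "(fst p + 2 * pi, snd p) \<in> \<Lambda>"
      then show False using xx by (auto simp: \<Lambda>_def)
    qed
    show "(x, y) \<in> \<Lambda>" "(x', y) \<in> \<Lambda>" by (simp_all add: \<Lambda>_def)
    show "\<not> ein_eq (x, y) (x', y)" using xx by (auto simp: ein_eq_def)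
    show "preserves (sL g) (sR g) \<Lambda>" for g
      unfolding preserves_def
    proof (intro allI impI)
      fix a b assume "(a, b) \<in> \<Lambda>"
      then obtain k :: int where k: "b = y + 2 * pi * k" "a = x + 2 * pi * k \<or> a = x' + 2 * pi * k" using mem by blast
      have "sL g a = a" "sR g b = b" using k L(1,3) L' R(1,3) Gt_fixed_shift by auto
      then show "(sL g a, sR g b) \<in> \<Lambda>" using \<open>(a, b) \<in> \<Lambda>\<close> by simp
    qed
  qed
qed

text \<open>A lift \<open>F\<close> of the intertwiner \<open>P\<close> satisfies
  \<open>sR g (F a) = F (sL g a)\<close>: both sides lift the same product and agree at
  \<open>x\<close>. So its graph is invariant, and since \<open>F\<close> increases and commutes
  with translation by 2 pi, the graph is achronal and generic.\<close>

lemma admissible_of_conjugate: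
  fixes rL rR :: "'g::ab_group_add \<Rightarrow> mat2 set"
  assumes hom: "psl_hom rL" "psl_hom rR" and fd: "faithful rL rR" "psl_discrete (rep_image rL rR)"
    and P: "P \<in> SL2" "cross (dir y) (P *v dir x) = 0"
    and x: "\<And>g. \<exists>A\<in>SL2. rL g = psl A \<and> cross (dir x) (A *v dir x) = 0 \<and>
      (\<exists>B\<in>SL2. rR g = psl B \<and> cross (dir y) (B *v dir y) = 0 \<and> P ** A = B ** P)"
  shows "admissible rL rR"
proof -
  obtain sL where L: "\<And>g. sL g \<in> Gt" "\<And>g. covers (sL g) (rL g)" "\<And>g. sL g x = x"
    "\<And>g h. sL (g + h) = (\<lambda>a. sL g (sL h a))"
    using fixed_point_lifts[OF hom(1), of x] x by metis
  obtain sR where R: "\<And>g. sR g \<in> Gt" "\<And>g. covers (sR g) (rR g)" "\<And>g. sR g y = y"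
    "\<And>g h. sR (g + h) = (\<lambda>a. sR g (sR h a))"
    using fixed_point_lifts[OF hom(2), of y] x by metis
  obtain F where F: "F \<in> Gt" "lifts F P" "F x = y" using lift_exists[OF P] .
  have comm: "sR g (F a) = F (sL g a)" for g a
  proof -
    obtain A B where AB: "A \<in> SL2" "rL g = psl A" "B \<in> SL2" "rR g = psl B" "P ** A = B ** P" using x[of g] by blast
    have "lifts (sL g) A" "lifts (sR g) B" using L(2)[of g] R(2)[of g] AB covers_psl by metis+
    then have "lifts (\<lambda>a. sR g (F a)) (P ** A)" "lifts (\<lambda>a. F (sL g a)) (P ** A)"
      using lifts_compose F(2) AB(5) by metis+
    moreover have "continuous_on UNIV (\<lambda>a. sR g (F a))" "continuous_on UNIV (\<lambda>a. F (sL g a))"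
      using continuous_on_compose2[OF Gt_continuous[OF R(1)] Gt_continuous[OF F(1)]]
        continuous_on_compose2[OF Gt_continuous[OF F(1)] Gt_continuous[OF L(1)]] by blast+
    ultimately have "(\<lambda>a. sR g (F a)) = (\<lambda>a. F (sL g a))"
      using lifts_eq_if_agree[OF _ _ SL2_mult[OF P(1) AB(1)], of _ _ x] L(3) R(3) F(3) by simp
    then show ?thesis by metis
  qed
  define \<Lambda> where "\<Lambda> = {p. snd p = F (fst p)}"
  have sat: "ein_saturated \<Lambda>"
    by (rule ein_saturatedI) (simp add: \<Lambda>_def Gt_shift_int[OF F(1)])
  show ?thesis
  proof (rule admissibleI[OF fd L(1,2,4) R(1,2,4) sat])
    have "continuous_on UNIV (\<lambda>p :: real \<times> real. F (fst p))"
      by (rule continuous_on_compose2[OF Gt_continuous[OF F(1)]]) (auto intro!: continuous_intros)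
    then show "closed \<Lambda>" unfolding \<Lambda>_def by (intro closed_Collect_eq continuous_intros)
    show "achronal \<Lambda>"
      by (rule achronalI[OF sat]) (use strict_monoD[OF Gt_strict_mono[OF F(1)]] in \<open>auto simp: \<Lambda>_def intro: less_imp_le\<close>)
    show "generic \<Lambda>" by (auto simp: generic_def \<Lambda>_def Gt_shift[OF F(1)])
    show "(0, F 0) \<in> \<Lambda>" "(pi, F pi) \<in> \<Lambda>" by (simp_all add: \<Lambda>_def)
    show "\<not> ein_eq (0, F 0) (pi, F pi)"
    proof
      assume "ein_eq (0, F 0) (pi, F pi)"
      \<comment> \<open>Equivalence of the two points would make pi a multiple of 2 pi.\<close>
      then obtain k :: int where "pi * 1 = pi * (2 * k)" by (auto simp: ein_eq_def)
      then have "1 = real_of_int (2 * k)" by (subst (asm) mult_left_cancel) auto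
      then have "1 = 2 * k" by linarith
      then show False by presburger
    qed
    show "preserves (sL g) (sR g) \<Lambda>" for g
      by (simp add: preserves_def \<Lambda>_def comm)
  qed
qed

section \<open>Assembling the converse from the model subgroups\<close>

lemma cross_self [simp]: "cross u u = 0" by (simp add: cross_def)

lemma conj_eigendirection:
  assumes "M \<in> SL2" "M *v dir x = c *\<^sub>R v" "cross v (E *v v) = 0"
  shows "cross (dir x) ((adj2 M ** E ** M) *v dir x) = 0"
  unfolding cross_conj[OF assms(1)] assms(2) by (simp add: matrix_vector_mult_scaleR assms(3))

lemma psl_conj_eqD:
  assumes "psl_hom r" "M \<in> SL2" "psl_conj M (r g) = psl E"
  shows "r g = psl (adj2 M ** E ** M)"
proof -
  obtain A where A: "r g = psl A" using psl_hom_rep[OF assms(1)] by metis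
  show ?thesis using psl_conj_eq_psl_iff[OF assms(2)] assms(3) unfolding A by blast
qed

lemma admissible_of_subgroup:
  fixes rL rR :: "'g::ab_group_add \<Rightarrow> mat2 set"
  assumes hom: "psl_hom rL" "psl_hom rR" and fd: "faithful rL rR" "psl_discrete (rep_image rL rR)"
    and M: "M \<in> SL2" and N: "N \<in> SL2"
    and S: "(\<forall>g. (psl_conj M (rL g), psl_conj N (rR g)) \<in> A_hyp) \<or> (\<forall>g. (psl_conj M (rL g), psl_conj N (rR g)) \<in> A_ext)
      \<or> (\<forall>g. (psl_conj M (rL g), psl_conj N (rR g)) \<in> A_par)"
  shows "admissible rL rR"
proof -
  have e: "vec2 1 0 \<noteq> 0" "vec2 0 1 \<noteq> 0" by (simp_all add: vec2_eq_iff)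
  obtain x c where x: "c \<noteq> 0" "M *v dir x = c *\<^sub>R vec2 1 0" using dir_preimage[OF M e(1)] .
  obtain y d where y: "d \<noteq> 0" "N *v dir y = d *\<^sub>R vec2 1 0" using dir_preimage[OF N e(1)] .
  have eig: "cross (vec2 1 0) (exp_Delta l *v vec2 1 0) = 0" "cross (vec2 0 1) (exp_Delta l *v vec2 0 1) = 0"
    "cross (vec2 1 0) (exp_H l *v vec2 1 0) = 0" for l
    by (simp_all add: cross_def matrix_vector_nth2 exp_Delta_def exp_H_def)
  show ?thesis
  proof (cases "\<forall>g. (psl_conj M (rL g), psl_conj N (rR g)) \<in> A_par")
    case True
    \<comment> \<open>In \<open>A_par\<close> both conjugated representations coincide, so this
      matrix intertwines the original ones.\<close>
    let ?P = "adj2 N ** M"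
    have P: "?P \<in> SL2" using SL2_mult SL2_adj2 M N by blast
    have "?P *v dir x = c *\<^sub>R (adj2 N *v vec2 1 0)"
      unfolding matrix_vector_mul_assoc[symmetric] x(2) by (simp add: matrix_vector_mult_scaleR)
    moreover have "dir y = d *\<^sub>R (adj2 N *v vec2 1 0)"
      by (metis N adj2_mult(1) matrix_vector_mul_assoc matrix_vector_mul_lid matrix_vector_mult_scaleR y(2))
    ultimately have Pxy: "cross (dir y) (?P *v dir x) = 0" by simp
    have "\<exists>A\<in>SL2. rL g = psl A \<and> cross (dir x) (A *v dir x) = 0 \<and>
      (\<exists>B\<in>SL2. rR g = psl B \<and> cross (dir y) (B *v dir y) = 0 \<and> ?P ** A = B ** ?P)" for g
    proof -
      obtain l where l: "psl_conj M (rL g) = psl (exp_H l)" "psl_conj N (rR g) = psl (exp_H l)"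
        using True[rule_format, of g] by (auto simp: A_par_def)
      let ?A = "adj2 M ** exp_H l ** M" and ?B = "adj2 N ** exp_H l ** N"
      have "?P ** ?A = adj2 N ** (M ** adj2 M) ** exp_H l ** M" by (simp only: matrix_mul_assoc)
      also have "\<dots> = adj2 N ** exp_H l ** (N ** adj2 N) ** M"
        unfolding adj2_mult(2)[OF M] adj2_mult(2)[OF N] matrix_mul_rid ..
      also have "\<dots> = ?B ** ?P" by (simp only: matrix_mul_assoc)
      finally have "?P ** ?A = ?B ** ?P" .
      moreover have "cross (dir x) (?A *v dir x) = 0" "cross (dir y) (?B *v dir y) = 0"
        using conj_eigendirection[OF M x(2) eig(3)] conj_eigendirection[OF N y(2) eig(3)] by auto
      ultimately show ?thesis
        using psl_conj_eqD[OF hom(1) M l(1)] psl_conj_eqD[OF hom(2) N l(2)] SL2_conj[OF M SL2_exp_H]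
          SL2_conj[OF N SL2_exp_H] by blast
    qed
    then show ?thesis by (rule admissible_of_conjugate[OF hom fd P Pxy])
  next
    case False
    \<comment> \<open>\<open>A_hyp\<close> and \<open>A_ext\<close> are treated together: the left
      factor has two common eigendirections, the coordinate axes in the frame of \<open>M\<close>,
      and the right factor has at least one.\<close>
    then have LR: "(\<exists>l. psl_conj M (rL g) = psl (exp_Delta l)) \<and>
        ((\<exists>l. psl_conj N (rR g) = psl (exp_Delta l)) \<or> (\<exists>l. psl_conj N (rR g) = psl (exp_H l)))" for g
      using S unfolding A_hyp_def A_ext_def by blast
    obtain x' c' where x': "c' \<noteq> 0" "M *v dir x' = c' *\<^sub>R vec2 0 1" using dir_preimage[OF M e(2)] .
    obtain k :: int where k: "x + 2 * pi * k \<le> x'" "x' < x + 2 * pi * k + 2 * pi" by (rule period_reduce)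
    \<comment> \<open>The second axis is moved by whole periods into the interval from
      \<open>x\<close> to x + 2 pi; it cannot land on \<open>x\<close>, because \<open>M\<close>
      sends the two directions to different axes.\<close>
    define x'' where "x'' = x' + 2 * pi * of_int (- k)"
    obtain c'' where c'': "dir x'' = c'' *\<^sub>R dir x'" using dir_parallel_iff x''_def by blast
    have Mx'': "M *v dir x'' = (c'' * c') *\<^sub>R vec2 0 1" unfolding c'' by (simp add: matrix_vector_mult_scaleR x'(2))
    have "x'' \<noteq> x"
    proof
      assume "x'' = x"
      then have "(c'' * c') *\<^sub>R vec2 0 1 = c *\<^sub>R vec2 1 0" using Mx'' x(2) by simp
      then show False using x(1) by (simp add: vec2_eq_iff)
    qed
    then have xx: "x < x''" "x'' < x + 2 * pi" using k by (auto simp: x''_def)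
    show ?thesis
    proof (rule admissible_of_fixed_points[OF hom fd _ xx])
      fix g
      obtain l where l: "psl_conj M (rL g) = psl (exp_Delta l)" using LR by blast
      show "\<exists>A\<in>SL2. rL g = psl A \<and> cross (dir x) (A *v dir x) = 0 \<and> cross (dir x'') (A *v dir x'') = 0"
        using psl_conj_eqD[OF hom(1) M l] SL2_conj[OF M SL2_exp_Delta]
          conj_eigendirection[OF M x(2) eig(1)] conj_eigendirection[OF M Mx'' eig(2)] by blast
      obtain E where E: "psl_conj N (rR g) = psl E" "E \<in> SL2" "cross (vec2 1 0) (E *v vec2 1 0) = 0"
        using LR[of g] eig SL2_exp_Delta SL2_exp_H by metis
      show "\<exists>A\<in>SL2. rR g = psl A \<and> cross (dir y) (A *v dir y) = 0"
        using psl_conj_eqD[OF hom(2) N E(1)] SL2_conj[OF N E(2)] conj_eigendirection[OF N y(2) E(3)] by blast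
    qed
  qed
qed

lemma psl_discrete_conj_rep_image:
  assumes "M \<in> SL2" "N \<in> SL2" "psl_discrete {(psl_conj M (rL g), psl_conj N (rR g)) | g. True}"
  shows "psl_discrete (rep_image rL rR)"
proof -
  have "(\<lambda>(X, Y). (psl_conj (adj2 M) X, psl_conj (adj2 N) Y)) ` (\<lambda>(X, Y). (psl_conj M X, psl_conj N Y)) ` rep_image rL rR
      = rep_image rL rR"
    unfolding image_image by (simp add: case_prod_beta psl_conj_adj2 assms(1,2))
  then show ?thesis
    using psl_discrete_conj[OF SL2_adj2[OF assms(1)] SL2_adj2[OF assms(2)]] assms(3)
    unfolding conj_image_eq by metis
qed

lemma standard_form_imp_admissible:
  fixes rL rR :: "'g::ab_group_add \<Rightarrow> mat2 set"
  assumes hom: "psl_hom rL" "psl_hom rR" and f: "faithful rL rR" and sf: "in_standard_form rL rR"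
  shows "admissible rL rR"
proof -
  obtain M N sw where MN: "M \<in> SL2" "N \<in> SL2" and
    S: "psl_discrete ((if sw then prod.swap else id) ` {(psl_conj M (rL g), psl_conj N (rR g)) | g. True})"
    "(if sw then prod.swap else id) ` {(psl_conj M (rL g), psl_conj N (rR g)) | g. True} \<subseteq> A_hyp \<or>
     (if sw then prod.swap else id) ` {(psl_conj M (rL g), psl_conj N (rR g)) | g. True} \<subseteq> A_ext \<or>
     (if sw then prod.swap else id) ` {(psl_conj M (rL g), psl_conj N (rR g)) | g. True} \<subseteq> A_par"
    using sf unfolding in_standard_form_def Let_def by blast
  show ?thesis
  proof (cases sw)
    case False
    then show ?thesis
      using S psl_discrete_conj_rep_image[OF MN] by (intro admissible_of_subgroup[OF hom f _ MN]) auto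
  next
    case True
    have eq: "prod.swap ` {(psl_conj M (rL g), psl_conj N (rR g)) | g. True} = {(psl_conj N (rR g), psl_conj M (rL g)) | g. True}"
      by force
    have S': "psl_discrete {(psl_conj N (rR g), psl_conj M (rL g)) | g. True}"
      "{(psl_conj N (rR g), psl_conj M (rL g)) | g. True} \<subseteq> A_hyp \<or>
       {(psl_conj N (rR g), psl_conj M (rL g)) | g. True} \<subseteq> A_ext \<or>
       {(psl_conj N (rR g), psl_conj M (rL g)) | g. True} \<subseteq> A_par"
      using S True unfolding eq[symmetric] by simp_all
    \<comment> \<open>With the factors exchanged, \<open>admissible_of_subgroup\<close> applies to
      (rR, rL); symmetry of admissibility returns to the original order.\<close>
    have "faithful rR rL" using f unfolding faithful_def inj_def by blast
    then have "admissible rR rL"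
      using S' psl_discrete_conj_rep_image[OF MN(2,1)] by (intro admissible_of_subgroup[OF hom(2,1) _ _ MN(2,1)]) auto
    then show ?thesis by (rule admissible_swap)
  qed
qed

theorem mainTheorem7:
  fixes \<rho>L \<rho>R :: "'g::ab_group_add \<Rightarrow> mat2 set"
  assumes "torsion_free TYPE('g)"
    and "psl_hom \<rho>L" and "psl_hom \<rho>R"
    and "faithful \<rho>L \<rho>R"
  shows "admissible \<rho>L \<rho>R \<longleftrightarrow>
    (\<exists>M\<in>SL2. \<exists>N\<in>SL2. \<exists>sw::bool.
       (let S = (if sw then prod.swap else id) `
                  {(psl_conj M (\<rho>L g), psl_conj N (\<rho>R g)) | g. True}
        in psl_discrete S \<and> (S \<subseteq> A_hyp \<or> S \<subseteq> A_ext \<or> S \<subseteq> A_par)))"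
  using admissible_imp_standard_form[OF assms(1-3)] standard_form_imp_admissible[OF assms(2-4)]
  unfolding in_standard_form_def by blast

end
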